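(* There is a polynomial-time algorithm that, given an arbitrary graph $G$, computes the minimum number of exclusive vertex splits required to transform $G$ into a linear forest.
   Context: All graphs are finite, simple and undirected. An exclusive vertex split of a vertex $v$ in a graph $G$ removes $v$ and adds two new vertices $v_1,v_2$ with $N(v_1)\cup N(v_2)=N(v)$ and $N(v_1)\cap N(v_2)=\emptyset$; no other adjacencies change. A linear forest is a graph all of whose connected components are paths. *)

theory Defs
  imports "Graph_Theory.Graph_Theory" "HOL-Computational_Algebra.Polynomial"
begin

section \<open>Splitting graphs into linear forests\<close>

text \<open>
  A finite simple undirected graph is a \<^locale>\<open>pair_graph\<close>: a finite loop-free digraph
  with a symmetric set of arcs, so that an edge between \<open>u\<close> and \<open>v\<close> is the pair of arcs
  \<open>(u, v)\<close> and \<open>(v, u)\<close>.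
\<close>

definition nbrs :: "'a pair_pre_digraph \<Rightarrow> 'a \<Rightarrow> 'a set" where
  "nbrs G v = {w. (v, w) \<in> parcs G}"

text \<open>
  \<open>N1\<close> and \<open>N2\<close> become the neighbourhoods of \<open>v1\<close> and \<open>v2\<close>; either of them may be empty.
\<close>

inductive exclusive_split :: "'a pair_pre_digraph \<Rightarrow> 'a pair_pre_digraph \<Rightarrow> bool" where
  "\<lbrakk>v \<in> pverts G; v1 \<notin> pverts G; v2 \<notin> pverts G; v1 \<noteq> v2;
    N1 \<union> N2 = nbrs G v; N1 \<inter> N2 = {}\<rbrakk> \<Longrightarrow>
   exclusive_split G
     \<lparr>pverts = (pverts G - {v}) \<union> {v1, v2},
      parcs = {(x, y) \<in> parcs G. x \<noteq> v \<and> y \<noteq> v}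
        \<union> {v1} \<times> N1 \<union> N1 \<times> {v1} \<union> {v2} \<times> N2 \<union> N2 \<times> {v2}\<rparr>"

definition path_graph :: "('a, 'a \<times> 'a) pre_digraph \<Rightarrow> bool" where
  "path_graph H \<longleftrightarrow> (\<exists>xs. xs \<noteq> [] \<and> distinct xs \<and> verts H = set xs \<and>
     arcs H = {(xs ! i, xs ! j) | i j.
       i < length xs \<and> j < length xs \<and> (j = Suc i \<or> i = Suc j)})"

text \<open>
  As arcs are symmetric, the strongly connected components are the connected components.
\<close>

definition linear_forest :: "'a pair_pre_digraph \<Rightarrow> bool" where
  "linear_forest G \<longleftrightarrow> (\<forall>H \<in> pre_digraph.sccs (with_proj G). path_graph H)"

definition splits_to_linear_forest :: "'a pair_pre_digraph \<Rightarrow> nat \<Rightarrow> bool" where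
  "splits_to_linear_forest G k \<longleftrightarrow> (\<exists>H. (exclusive_split ^^ k) G H \<and> linear_forest H)"

definition min_number_of_splits :: "'a pair_pre_digraph \<Rightarrow> nat \<Rightarrow> bool" where
  "min_number_of_splits G k \<longleftrightarrow>
     splits_to_linear_forest G k \<and> (\<forall>j. splits_to_linear_forest G j \<longrightarrow> k \<le> j)"

section \<open>Random access machines\<close>

text \<open>
  The model of computation is a random access machine with unit cost per instruction.
  Since addition and (truncated) subtraction are the only arithmetic, the bit length of any
  stored number grows by at most one per step (beyond the program's constants and the input
  numbers), so polynomial time here is polynomial time on Turing machines.

  Registers are addressed directly by the program, memory cells only through registers.
\<close>

datatype instr =
    LI nat nat        \<comment> \<open>\<open>LI i c\<close>: register \<open>i\<close> := \<open>c\<close>\<close>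
  | ADD nat nat nat   \<comment> \<open>\<open>ADD i j k\<close>: register \<open>i\<close> := register \<open>j\<close> + register \<open>k\<close>\<close>
  | SUB nat nat nat   \<comment> \<open>\<open>SUB i j k\<close>: register \<open>i\<close> := register \<open>j\<close> - register \<open>k\<close>\<close>
  | LD nat nat        \<comment> \<open>\<open>LD i j\<close>: register \<open>i\<close> := memory at (register \<open>j\<close>)\<close>
  | ST nat nat        \<comment> \<open>\<open>ST i j\<close>: memory at (register \<open>i\<close>) := register \<open>j\<close>\<close>
  | JNZ nat nat       \<comment> \<open>\<open>JNZ i l\<close>: continue at instruction \<open>l\<close> if register \<open>i\<close> is nonzero\<close>

record ram_state =
  pc :: nat
  reg :: "nat \<Rightarrow> nat"
  mem :: "nat \<Rightarrow> nat"

fun exec :: "instr \<Rightarrow> ram_state \<Rightarrow> ram_state" where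
  "exec (LI i c) s = s\<lparr>pc := Suc (pc s), reg := (reg s)(i := c)\<rparr>"
| "exec (ADD i j k) s = s\<lparr>pc := Suc (pc s), reg := (reg s)(i := reg s j + reg s k)\<rparr>"
| "exec (SUB i j k) s = s\<lparr>pc := Suc (pc s), reg := (reg s)(i := reg s j - reg s k)\<rparr>"
| "exec (LD i j) s = s\<lparr>pc := Suc (pc s), reg := (reg s)(i := mem s (reg s j))\<rparr>"
| "exec (ST i j) s = s\<lparr>pc := Suc (pc s), mem := (mem s)(reg s i := reg s j)\<rparr>"
| "exec (JNZ i l) s = s\<lparr>pc := (if reg s i \<noteq> 0 then l else Suc (pc s))\<rparr>"

definition halted :: "instr list \<Rightarrow> ram_state \<Rightarrow> bool" where
  "halted P s \<longleftrightarrow> length P \<le> pc s"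

definition step :: "instr list \<Rightarrow> ram_state \<Rightarrow> ram_state" where
  "step P s = (if halted P s then s else exec (P ! pc s) s)"

definition initial_state :: "nat list \<Rightarrow> ram_state" where
  "initial_state x =
     \<lparr>pc = 0, reg = (\<lambda>_. 0), mem = (\<lambda>a. if a < length x then x ! a else 0)\<rparr>"

text \<open>
  On input \<open>x\<close>, program \<open>P\<close> halts after at most \<open>t\<close> steps (a halted state no longer changes)
  with \<open>y\<close> in register 0.
\<close>

definition computes_within :: "instr list \<Rightarrow> nat list \<Rightarrow> nat \<Rightarrow> nat \<Rightarrow> bool" where
  "computes_within P x t y \<longleftrightarrow>
     (let s = (step P ^^ t) (initial_state x) in halted P s \<and> reg s 0 = y)"

text \<open>
  The number of vertices followed by the rows of the adjacency matrix, with respect to the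
  listing \<open>vs\<close> of the vertices.
\<close>

definition encode_graph :: "'a pair_pre_digraph \<Rightarrow> 'a list \<Rightarrow> nat list" where
  "encode_graph G vs =
     length vs # [if (u, v) \<in> parcs G then 1 else 0. u \<leftarrow> vs, v \<leftarrow> vs]"

end

theory Submission
  imports Defs
begin

text \<open>
  Let the cost of a graph be the sum of \<open>\<lceil>d(v) / 2\<rceil>\<close> over its vertices plus the number of components
  all of whose degrees are even (isolated vertices included). The cost is at least the number of
  vertices, with equality exactly for linear forests. A split adds one vertex and never decreases
  the cost: splitting an even degree into two odd ones may destroy an even component, but also
  raises the sum of halves by one. Unless the graph is a linear forest, some split leaves the cost
  unchanged: in an even component with an edge, cut off a single neighbour; otherwise take a
  vertex of degree at least three in a component with odd vertices and cut off two neighbours,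
  chosen by a parity argument so that both new vertices stay connected to an odd vertex. Hence
  the minimum is the cost minus the number of vertices. It is computed in cubic time by merging
  the labels of adjacent vertices.
\<close>

section \<open>Costs of splits\<close>

text \<open>The cost counts the vertices that a final linear forest must have. Its degrees are at
  most two, so a vertex of degree d ends up as at least \<lceil>d / 2\<rceil> pieces. This count
  misses two situations: degree 0 rounds to no piece at all, and a component with only even degrees,
  cut into pieces of degree exactly two, consists of cycles, so that one more cut is needed. A
  single summand repairs both, since an isolated vertex is itself an even component. In a component
  with odd vertices the obstacle is not the sum of halves: cutting off two neighbours lowers
  \<lceil>d / 2\<rceil> by exactly one and adds one. It is that a copy might be detached together
  with vertices of even degree only, which creates a new even component. By a handshake argument
  \<open>v\<close> has an even number of edges into those parts of the graph without
  \<open>v\<close> that contain no odd vertex, and this parity decides which neighbours can be cut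
  off.\<close>

abbreviation deg :: "'a rel \<Rightarrow> 'a \<Rightarrow> nat" where
  "deg E v \<equiv> card (E `` {v})"

abbreviation component :: "'a rel \<Rightarrow> 'a \<Rightarrow> 'a set" where
  "component E v \<equiv> E\<^sup>* `` {v}"

definition all_even :: "'a rel \<Rightarrow> 'a set \<Rightarrow> bool" where
  "all_even E C \<longleftrightarrow> (\<forall>w\<in>C. even (deg E w))"

definition even_comps :: "'a set \<Rightarrow> 'a rel \<Rightarrow> 'a set set" where
  "even_comps V E = {C \<in> component E ` V. all_even E C}"

definition cost :: "'a set \<Rightarrow> 'a rel \<Rightarrow> nat" where
  "cost V E = (\<Sum>v\<in>V. (deg E v + 1) div 2) + card (even_comps V E)"

text \<open>The handshake lemma for relations: arcs pair off with their reversals, and without loops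
  the two members of a pair differ.\<close>

lemma even_card_sym_irrefl:
  assumes "finite R" "sym R" "irrefl R"
  shows "even (card R)"
  using assms
proof (induction R rule: finite_psubset_induct)
  case (psubset R)
  show ?case
  proof (cases "R = {}")
    case False
    then obtain a b where ab: "(a, b) \<in> R"
      by auto
    then have ba: "(b, a) \<in> R" "a \<noteq> b"
      using psubset.prems by (auto dest: symD simp: irrefl_def)
    let ?R = "R - {(a, b), (b, a)}"
    have "sym ?R" "irrefl ?R"
      using psubset.prems unfolding sym_def irrefl_def by blast+
    then have "even (card ?R)"
      using ab by (intro psubset.IH) auto
    moreover have "card R = card ?R + card {(a, b), (b, a)}"
      using ab ba psubset.hyps by (intro card_Int_Diff[of R "{(a, b), (b, a)}", THEN trans]) auto
    moreover have "card {(a, b), (b, a)} = 2"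
      using ba(2) by simp
    ultimately show ?thesis
      by simp
  qed simp
qed

section \<open>Degree parities and the cost of a single graph\<close>

locale simple_graph =
  fixes V :: "'a set" and E :: "'a rel"
  assumes finite_V: "finite V" and E_subset: "E \<subseteq> V \<times> V" and sym_E: "sym E" and irrefl_E: "irrefl E"
begin

lemma finite_E: "finite E"
  using finite_subset[OF E_subset] finite_V by simp

lemma finite_nbrs: "finite (E `` {v})"
  using finite_E by (rule finite_Image)

lemma nbrs_subset: "E `` {v} \<subseteq> V"
  using E_subset by blast

lemma E_sym: "(x, y) \<in> E \<Longrightarrow> (y, x) \<in> E"
  using sym_E by (rule symD)

lemma E_V: "(x, y) \<in> E \<Longrightarrow> x \<in> V \<and> y \<in> V"
  using E_subset by blast

lemma E_irrefl: "(x, x) \<notin> E"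
  using irrefl_E by (simp add: irrefl_def)

lemma conn_sym: "(x, y) \<in> E\<^sup>* \<Longrightarrow> (y, x) \<in> E\<^sup>*"
  using sym_rtrancl[OF sym_E] by (rule symD)

lemma comp_eq_iff: "component E x = component E y \<longleftrightarrow> (x, y) \<in> E\<^sup>*"
proof
  assume "(x, y) \<in> E\<^sup>*"
  then show "component E x = component E y"
    using conn_sym by (auto intro: rtrancl_trans)
qed auto

lemma comp_subset: "v \<in> V \<Longrightarrow> component E v \<subseteq> V"
proof
  fix w assume "v \<in> V" "w \<in> component E v"
  then have "(v, w) \<in> E\<^sup>*" by simp
  then show "w \<in> V"
    using \<open>v \<in> V\<close> E_V by (induction rule: rtrancl_induct) auto
qed

lemma deg_0_iff: "deg E v = 0 \<longleftrightarrow> E `` {v} = {}"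
  using finite_nbrs by simp

lemma comp_deg_0: "deg E v = 0 \<Longrightarrow> component E v = {v}"
  unfolding deg_0_iff by (auto elim: converse_rtranclE)

lemma finite_even_comps: "finite (even_comps V E)"
  using finite_V by (simp add: even_comps_def)

text \<open>The handshake argument confined to a part \<open>T\<close> of the graph without
  \<open>v\<close>: the even degree sum over \<open>T\<close> counts the arcs inside
  \<open>T\<close>, which pair off, and the arcs from \<open>T\<close> to \<open>v\<close>.\<close>

lemma even_card_boundary:
  assumes "T \<subseteq> V - {v}" and "\<And>x y. x \<in> T \<Longrightarrow> (x, y) \<in> E \<Longrightarrow> y \<noteq> v \<Longrightarrow> y \<in> T"
    and "all_even E T"
  shows "even (card (E `` {v} \<inter> T))"
proof -
  let ?R = "E \<inter> T \<times> T" and ?B = "(\<lambda>x. (x, v)) ` (E `` {v} \<inter> T)"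
  have fin: "finite T"
    using assms(1) finite_V finite_subset by blast
  \<comment> \<open>As \<open>T\<close> is closed under adjacency away from \<open>v\<close>, an arc
    leaving \<open>T\<close> can only end in \<open>v\<close>.\<close>
  have "(SIGMA x:T. E `` {x}) = ?R \<union> ?B"
    using assms(1,2) E_sym by blast
  moreover have "?R \<inter> ?B = {}"
    using assms(1) by auto
  moreover have "finite ?R" "finite ?B"
    using finite_E fin by auto
  ultimately have "card (SIGMA x:T. E `` {x}) = card ?R + card ?B"
    by (simp add: card_Un_disjoint)
  moreover have "card ?B = card (E `` {v} \<inter> T)"
    by (rule card_image) (auto simp: inj_on_def)
  moreover have "card (SIGMA x:T. E `` {x}) = (\<Sum>x\<in>T. deg E x)"
    using fin finite_nbrs by simp
  moreover have "even (\<Sum>x\<in>T. deg E x)"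
    using assms(3) by (intro dvd_sum) (simp add: all_even_def)
  moreover have "even (card ?R)"
    using sym_E irrefl_E finite_E
    by (intro even_card_sym_irrefl) (auto simp: sym_def irrefl_def)
  ultimately show ?thesis
    by (metis even_add)
qed

lemma card_isolated: "card {v \<in> V. deg E v = 0} = (\<Sum>v\<in>V. if deg E v = 0 then 1 else 0)"
  using sum.inter_filter[OF finite_V, of "\<lambda>_. 1::nat"] by simp

text \<open>A vertex of positive degree pays for itself in the sum; an isolated one pays as a
  singleton even component.\<close>

lemma card_le_cost: "card V \<le> cost V E"
proof -
  let ?I = "{v \<in> V. deg E v = 0}"
  have "(\<lambda>v. {v}) ` ?I \<subseteq> even_comps V E"
  proof
    fix C assume "C \<in> (\<lambda>v. {v}) ` ?I"
    then obtain v where "v \<in> V" "deg E v = 0" "C = {v}"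
      by blast
    then show "C \<in> even_comps V E"
      using comp_deg_0[of v] by (auto simp: even_comps_def all_even_def)
  qed
  then have "card ((\<lambda>v. {v}) ` ?I) \<le> card (even_comps V E)"
    by (rule card_mono[OF finite_even_comps])
  then have "card ?I \<le> card (even_comps V E)"
    by (simp add: card_image)
  moreover have "(\<Sum>v\<in>V. 1) \<le> (\<Sum>v\<in>V. (deg E v + 1) div 2 + (if deg E v = 0 then 1 else 0))"
  proof (rule sum_mono)
    show "1 \<le> (d + 1) div 2 + (if d = 0 then 1 else 0)" for d :: nat
      by (cases d) simp_all
  qed
  ultimately show ?thesis
    unfolding cost_def card_isolated sum.distrib by simp
qed

text \<open>Now isolated vertices are the only even components, so every vertex contributes at most
  one through exactly one of the two summands.\<close>

lemma cost_le_card: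
  assumes "\<And>v. v \<in> V \<Longrightarrow> deg E v \<le> 2"
    and "\<And>v. v \<in> V \<Longrightarrow> all_even E (component E v) \<Longrightarrow> deg E v = 0"
  shows "cost V E \<le> card V"
proof -
  let ?I = "{v \<in> V. deg E v = 0}"
  have "even_comps V E \<subseteq> (\<lambda>v. {v}) ` ?I"
  proof
    fix C assume "C \<in> even_comps V E"
    then obtain v where "v \<in> V" "C = component E v" "all_even E C"
      by (auto simp: even_comps_def)
    moreover from this have "deg E v = 0"
      using assms(2) by blast
    ultimately show "C \<in> (\<lambda>v. {v}) ` ?I"
      using comp_deg_0[of v] by blast
  qed
  then have "card (even_comps V E) \<le> card ?I"
    using surj_card_le[of ?I "even_comps V E" "\<lambda>v. {v}"] finite_V by simp
  moreover have "(\<Sum>v\<in>V. (deg E v + 1) div 2 + (if deg E v = 0 then 1 else 0)) \<le> (\<Sum>v\<in>V. 1)"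
  proof (rule sum_mono)
    show "(deg E v + 1) div 2 + (if deg E v = 0 then 1 else 0) \<le> 1" if "v \<in> V" for v
      using assms(1)[OF that] by presburger
  qed
  ultimately show ?thesis
    unfolding cost_def card_isolated sum.distrib by simp
qed

end

section \<open>The effect of one split on degrees, components and cost\<close>

locale graph_split = simple_graph +
  fixes v v1 v2 :: 'a and N1 N2 :: "'a set"
  assumes v: "v \<in> V" and fresh: "v1 \<notin> V" "v2 \<notin> V" "v1 \<noteq> v2"
    and N: "N1 \<union> N2 = E `` {v}" "N1 \<inter> N2 = {}"
begin

definition V' :: "'a set" where
  "V' = (V - {v}) \<union> {v1, v2}"

definition E' :: "'a rel" where
  "E' = {(x, y) \<in> E. x \<noteq> v \<and> y \<noteq> v}
     \<union> {v1} \<times> N1 \<union> N1 \<times> {v1} \<union> {v2} \<times> N2 \<union> N2 \<times> {v2}"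

lemma N_subset: "N1 \<subseteq> V - {v}" "N2 \<subseteq> V - {v}"
  using N nbrs_subset[of v] E_irrefl by blast+

lemma in_N_iff: "x \<in> N1 \<or> x \<in> N2 \<longleftrightarrow> (v, x) \<in> E"
  using N by blast

sublocale split: simple_graph V' E'
proof
  show "finite V'"
    using finite_V by (simp add: V'_def)
  show "E' \<subseteq> V' \<times> V'"
    using E_subset N_subset unfolding E'_def V'_def by auto
  show "sym E'"
    using E_sym unfolding E'_def sym_def by blast
  show "irrefl E'"
    using E_irrefl N_subset fresh unfolding E'_def irrefl_def by blast
qed

lemma card_V': "card V' = Suc (card V)"
proof -
  have "card V' = card (V - {v}) + card {v1, v2}"
    unfolding V'_def using finite_V fresh by (intro card_Un_disjoint) auto
  then show ?thesis
    using fresh(3) card_Suc_Diff1[OF finite_V v] by simp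
qed

lemma nbrs_v1: "E' `` {v1} = N1"
  using fresh E_subset N_subset by (auto simp: E'_def)

lemma nbrs_v2: "E' `` {v2} = N2"
  using fresh E_subset N_subset by (auto simp: E'_def)

lemma card_N: "card N1 + card N2 = deg E v"
proof -
  have "finite N1" "finite N2"
    using finite_nbrs[of v] by (simp_all add: N(1)[symmetric])
  then show ?thesis
    using card_Un_disjoint[OF _ _ N(2)] by (simp add: N(1))
qed

text \<open>Disjointness of \<open>N1\<close> and \<open>N2\<close> gives a former neighbour of
  \<open>v\<close> exactly one of the two copies in exchange for \<open>v\<close>.\<close>

lemma deg_old:
  assumes "x \<in> V" "x \<noteq> v"
  shows "deg E' x = deg E x"
proof (cases "(v, x) \<in> E")
  case False
  then have "(x, v) \<notin> E" "x \<notin> N1" "x \<notin> N2"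
    using E_sym in_N_iff by blast+
  then have "E' `` {x} = E `` {x}"
    using assms fresh by (auto simp: E'_def)
  then show ?thesis
    by simp
next
  case True
  have *: "card (insert w (E `` {x} - {v})) = deg E x" if "w \<notin> V" for w
  proof -
    have "w \<notin> E `` {x} - {v}" "v \<in> E `` {x}"
      using that nbrs_subset[of x] E_sym[OF True] by auto
    then show ?thesis
      using finite_nbrs[of x] card_Suc_Diff1[of "E `` {x}" v] by (simp add: card_insert_disjoint)
  qed
  show ?thesis
  proof (cases "x \<in> N1")
    case True
    then have "E' `` {x} = insert v1 (E `` {x} - {v})"
      using assms fresh N by (auto simp: E'_def)
    then show ?thesis
      using *[OF fresh(1)] by simp
  next
    case False
    then have "x \<in> N2"
      using True in_N_iff by blast
    then have "E' `` {x} = insert v2 (E `` {x} - {v})"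
      using assms fresh N by (auto simp: E'_def)
    then show ?thesis
      using *[OF fresh(2)] by simp
  qed
qed

text \<open>Gluing the two copies together again is a homomorphism to the original graph, so a split
  never connects what was disconnected.\<close>

definition proj :: "'a \<Rightarrow> 'a" where
  "proj x = (if x = v1 \<or> x = v2 then v else x)"

lemma proj_conn: "(x, y) \<in> E'\<^sup>* \<Longrightarrow> (proj x, proj y) \<in> E\<^sup>*"
proof (induction rule: rtrancl_induct)
  case (step y z)
  have "(v, x) \<in> E \<and> (x, v) \<in> E \<and> proj x = x" if "x \<in> N1 \<union> N2" for x
    using that N(1) E_sym N_subset fresh by (auto simp: proj_def)
  moreover have "proj v1 = v" "proj v2 = v"
    by (simp_all add: proj_def)
  moreover have "proj x = x" if "x \<in> V" for x
    using that fresh by (auto simp: proj_def)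
  ultimately have "(proj y, proj z) \<in> E"
    using step.hyps(2) E_V[of y z] unfolding E'_def by auto
  with step.IH show ?case
    by simp
qed simp

lemma proj_old: "x \<in> V \<Longrightarrow> proj x = x"
  using fresh by (auto simp: proj_def)

lemma comp_old:
  assumes "x \<in> V" "v \<notin> component E x"
  shows "component E' x = component E x"
proof
  show "component E' x \<subseteq> component E x"
  proof
    fix y assume "y \<in> component E' x"
    then have "(x, proj y) \<in> E\<^sup>*"
      using proj_conn[of x y] proj_old[OF assms(1)] by simp
    with assms(2) show "y \<in> component E x"
      by (auto simp: proj_def split: if_splits)
  qed
  have "(x, y) \<in> E'\<^sup>*" if "(x, y) \<in> E\<^sup>*" for y
    using that
  proof (induction rule: rtrancl_induct)
    case (step y z)
    then have "(x, z) \<in> E\<^sup>*"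
      by simp
    then have "(y, z) \<in> E'"
      using step.hyps assms(2) by (auto simp: E'_def)
    with step.IH show ?case
      by simp
  qed simp
  then show "component E x \<subseteq> component E' x"
    by blast
qed

lemma conn_v1_or_v2:
  assumes "(v, x) \<in> E\<^sup>*" "x \<noteq> v"
  shows "(v1, x) \<in> E'\<^sup>* \<or> (v2, x) \<in> E'\<^sup>*"
proof -
  \<comment> \<open>The disjunct \<open>x = v\<close> restarts the claim whenever the walk returns
    to \<open>v\<close>; it then leaves through the copy that received the next edge.\<close>
  have "x = v \<or> (v1, x) \<in> E'\<^sup>* \<or> (v2, x) \<in> E'\<^sup>*"
    using assms(1)
  proof (induction rule: rtrancl_induct)
    case (step y z)
    show ?case
    proof (cases "y = v")
      case True
      then have "(v1, z) \<in> E' \<or> (v2, z) \<in> E'"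
        using step.hyps(2) in_N_iff by (auto simp: E'_def)
      then show ?thesis
        by auto
    next
      case False
      then have "z = v \<or> (y, z) \<in> E'"
        using step.hyps(2) by (auto simp: E'_def)
      then show ?thesis
        using step.IH False by (meson rtrancl.rtrancl_into_rtrancl)
    qed
  qed simp
  with assms(2) show ?thesis
    by simp
qed

definition untouched :: "'a set set" where
  "untouched = {C \<in> even_comps V E. v \<notin> C}"

text \<open>Being a set, it counts one component only when the two copies remain connected.\<close>

definition new_even :: "'a set set" where
  "new_even = {C \<in> {component E' v1, component E' v2}. all_even E' C}"

lemma finite_untouched: "finite untouched" "finite new_even"
  using finite_even_comps by (simp_all add: untouched_def new_even_def)

lemma card_even_comps:
  "card (even_comps V E) = card untouched + (if all_even E (component E v) then 1 else 0)"
proof -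
  have *: "C = component E v \<and> all_even E C" if "C \<in> even_comps V E" "v \<in> C" for C
    using that comp_eq_iff by (auto simp: even_comps_def)
  show ?thesis
  proof (cases "all_even E (component E v)")
    case True
    then have "even_comps V E = insert (component E v) untouched"
      using * imageI[OF v, of "component E"] unfolding untouched_def even_comps_def by blast
    moreover have "component E v \<notin> untouched"
      by (simp add: untouched_def)
    ultimately show ?thesis
      using True finite_untouched by simp
  next
    case False
    then have "even_comps V E = untouched"
      using * unfolding untouched_def by blast
    with False show ?thesis
      by simp
  qed
qed

lemma all_even_old:
  assumes "x \<in> V" "v \<notin> component E x"
  shows "all_even E' (component E x) \<longleftrightarrow> all_even E (component E x)"
proof -
  have "deg E' w = deg E w" if "w \<in> component E x" for w
    using that comp_subset[OF assms(1)] assms(2) by (intro deg_old) blast+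
  then show ?thesis
    unfolding all_even_def by simp
qed

lemma even_comps_split: "even_comps V' E' = untouched \<union> new_even"
proof
  show "even_comps V' E' \<subseteq> untouched \<union> new_even"
  proof
    fix C assume "C \<in> even_comps V' E'"
    then obtain x where x: "x \<in> V'" "C = component E' x" "all_even E' C"
      by (auto simp: even_comps_def)
    show "C \<in> untouched \<union> new_even"
    proof (cases "x \<in> V \<and> v \<notin> component E x")
      case True
      then show ?thesis
        using x comp_old[of x] all_even_old[of x] by (auto simp: untouched_def even_comps_def)
    next
      case False
      \<comment> \<open>What used to be connected to \<open>v\<close> now lies in the component of
        one of the copies.\<close>
      then have "x = v1 \<or> x = v2 \<or> (v1, x) \<in> E'\<^sup>* \<or> (v2, x) \<in> E'\<^sup>*"
        using x(1) conn_v1_or_v2[of x] conn_sym[of x v] by (auto simp: V'_def)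
      then have "C = component E' v1 \<or> C = component E' v2"
        using x(2) split.comp_eq_iff by blast
      then show ?thesis
        using x(3) by (auto simp: new_even_def)
    qed
  qed
  show "untouched \<union> new_even \<subseteq> even_comps V' E'"
  proof
    fix C assume "C \<in> untouched \<union> new_even"
    then show "C \<in> even_comps V' E'"
    proof
      assume "C \<in> new_even"
      then show ?thesis
        by (auto simp: new_even_def even_comps_def V'_def)
    next
      assume "C \<in> untouched"
      then obtain x where x: "x \<in> V" "C = component E x" "v \<notin> component E x" "all_even E C"
        by (auto simp: untouched_def even_comps_def)
      then have "x \<in> V'" "C = component E' x" "all_even E' C"
        using comp_old all_even_old by (auto simp: V'_def)
      then show ?thesis
        by (auto simp: even_comps_def)
    qed
  qed
qed

lemma card_even_comps_split: "card (even_comps V' E') = card untouched + card new_even"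
proof -
  have "C \<subseteq> V" if "C \<in> untouched" for C
    using that comp_subset by (auto simp: untouched_def even_comps_def)
  then have "untouched \<inter> new_even = {}"
    using fresh by (auto simp: new_even_def)
  then show ?thesis
    unfolding even_comps_split using finite_untouched by (simp add: card_Un_disjoint)
qed

lemma sum_split:
  "(\<Sum>x\<in>V'. (deg E' x + 1) div 2) + (deg E v + 1) div 2 =
   (\<Sum>x\<in>V. (deg E x + 1) div 2) + (card N1 + 1) div 2 + (card N2 + 1) div 2"
proof -
  have "(\<Sum>x\<in>V'. (deg E' x + 1) div 2) =
      (\<Sum>x\<in>V - {v}. (deg E' x + 1) div 2) + (\<Sum>x\<in>{v1, v2}. (deg E' x + 1) div 2)"
    unfolding V'_def using finite_V fresh by (intro sum.union_disjoint) auto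
  moreover have "(\<Sum>x\<in>V - {v}. (deg E' x + 1) div 2) = (\<Sum>x\<in>V - {v}. (deg E x + 1) div 2)"
    using deg_old by (intro sum.cong) auto
  moreover have "(\<Sum>x\<in>V. (deg E x + 1) div 2) =
      (deg E v + 1) div 2 + (\<Sum>x\<in>V - {v}. (deg E x + 1) div 2)"
    using finite_V v by (rule sum.remove)
  ultimately show ?thesis
    using fresh by (simp add: nbrs_v1 nbrs_v2)
qed

text \<open>Both copies then have even degree, and the other vertices that \<open>v1\<close> still
  reaches come from the old component of \<open>v\<close>, so the component of \<open>v1\<close>
  inherits its evenness.\<close>

lemma new_even_nonempty:
  assumes "all_even E (component E v)" "even (card N1)"
  shows "component E' v1 \<in> new_even"
proof -
  have "even (deg E' w)" if "(v1, w) \<in> E'\<^sup>*" for w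
  proof -
    have "even (card N2)"
      using assms card_N even_add unfolding all_even_def by (metis Image_singleton_iff rtrancl.rtrancl_refl)
    moreover have "w \<in> V'"
      using that split.comp_subset[of v1] by (auto simp: V'_def)
    moreover have "even (deg E w)" if "w \<in> V" "w \<noteq> v"
      using assms(1) proj_conn[OF \<open>(v1, w) \<in> E'\<^sup>*\<close>] proj_old[OF that(1)]
      by (simp add: all_even_def proj_def)
    ultimately show ?thesis
      using assms(2) deg_old by (auto simp: V'_def nbrs_v1 nbrs_v2)
  qed
  then show ?thesis
    by (simp add: new_even_def all_even_def)
qed

lemma cost_le_split: "cost V E \<le> cost V' E'"
proof -
  let ?d = "deg E v" and ?a = "card N1" and ?b = "card N2"
  have d: "?d = ?a + ?b"
    using card_N by simp
  have "card (even_comps V E) + (?d + 1) div 2 \<le>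
      card (even_comps V' E') + (?a + 1) div 2 + (?b + 1) div 2"
  proof (cases "all_even E (component E v)")
    case False
    \<comment> \<open>Only the component of \<open>v\<close> can drop out of the count, and it was
      not counted.\<close>
    then have "card (even_comps V E) \<le> card (even_comps V' E')"
      by (simp add: card_even_comps card_even_comps_split)
    moreover have "(?d + 1) div 2 \<le> (?a + 1) div 2 + (?b + 1) div 2"
      unfolding d by presburger
    ultimately show ?thesis
      by linarith
  next
    case True
    then have "even ?d"
      unfolding all_even_def by blast
    show ?thesis
    proof (cases "even ?a")
      case True
      then have "card new_even \<noteq> 0"
        using new_even_nonempty[OF \<open>all_even E (component E v)\<close>] finite_untouched(2) by auto
      then have "card (even_comps V E) \<le> card (even_comps V' E')"
        by (simp add: card_even_comps card_even_comps_split)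
      moreover have "(?d + 1) div 2 \<le> (?a + 1) div 2 + (?b + 1) div 2"
        unfolding d by presburger
      ultimately show ?thesis
        by linarith
    next
      case False
      have "card (even_comps V E) \<le> card (even_comps V' E') + 1"
        by (simp add: card_even_comps card_even_comps_split)
      moreover have "(?d + 1) div 2 + 1 = (?a + 1) div 2 + (?b + 1) div 2"
        using False \<open>even ?d\<close> unfolding d by presburger
      ultimately show ?thesis
        by linarith
    qed
  qed
  then show ?thesis
    using sum_split unfolding cost_def by linarith
qed

lemma new_even_empty:
  assumes "(v1, x) \<in> E'\<^sup>*" "odd (deg E' x)" "(v2, y) \<in> E'\<^sup>*" "odd (deg E' y)"
  shows "card new_even = 0"
proof -
  have "\<not> all_even E' (component E' v1)" "\<not> all_even E' (component E' v2)"
    using assms unfolding all_even_def by blast+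
  then have "new_even = {}"
    unfolding new_even_def by blast
  then show ?thesis
    by simp
qed

lemma cost_split_even:
  assumes "all_even E (component E v)" "odd (card N1)"
  shows "cost V' E' = cost V E"
proof -
  have "even (card N1 + card N2)"
    using assms(1) unfolding card_N all_even_def by blast
  then have "odd (card N2)"
    using assms(2) by simp
  \<comment> \<open>Each copy has odd degree and is itself the odd vertex of its component.\<close>
  then have "card new_even = 0"
    using assms(2) by (intro new_even_empty[of v1 v2]) (simp_all add: nbrs_v1 nbrs_v2)
  then have "card (even_comps V E) = card (even_comps V' E') + 1"
    using assms(1) by (simp add: card_even_comps card_even_comps_split)
  moreover have "(deg E v + 1) div 2 + 1 = (card N1 + 1) div 2 + (card N2 + 1) div 2"
    using assms(2) \<open>odd (card N2)\<close> unfolding card_N[symmetric] by presburger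
  ultimately show ?thesis
    using sum_split unfolding cost_def by linarith
qed

text \<open>With two neighbours in \<open>N1\<close> the rounded halves add up exactly for either
  parity of the degree, so only a new even component could raise the cost.\<close>

lemma cost_split_odd:
  assumes "\<not> all_even E (component E v)" "card N1 = 2" "card new_even = 0"
  shows "cost V' E' = cost V E"
proof -
  have "card (even_comps V E) = card (even_comps V' E')"
    using assms(1,3) by (simp add: card_even_comps card_even_comps_split)
  moreover have "(deg E v + 1) div 2 = (card N1 + 1) div 2 + (card N2 + 1) div 2"
    using assms(2) unfolding card_N[symmetric] by simp
  ultimately show ?thesis
    using sum_split unfolding cost_def by linarith
qed

end

section \<open>Linear forests by degrees and parity, and the choice of a free split\<close>

definition path_on :: "'a rel \<Rightarrow> 'a set \<Rightarrow> bool" where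
  "path_on E C \<longleftrightarrow> (\<exists>xs. xs \<noteq> [] \<and> distinct xs \<and> C = set xs \<and>
     E \<inter> C \<times> C = {(xs ! i, xs ! j) | i j.
       i < length xs \<and> j < length xs \<and> (j = Suc i \<or> i = Suc j)})"

context simple_graph
begin

text \<open>Walks avoiding \<open>v\<close> survive every split of \<open>v\<close>. The degree is
  taken in the whole graph because that is what a vertex other than \<open>v\<close> keeps after the
  split.\<close>

definition reaches_odd :: "'a \<Rightarrow> 'a \<Rightarrow> bool" where
  "reaches_odd v x \<longleftrightarrow> (\<exists>w. (x, w) \<in> {(x, y) \<in> E. x \<noteq> v \<and> y \<noteq> v}\<^sup>* \<and> odd (deg E w))"

text \<open>The vertices that reach no odd vertex around \<open>v\<close> have even degrees and form
  a set closed under adjacency away from \<open>v\<close>, as \<open>even_card_boundary\<close>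
  requires.\<close>

lemma even_card_not_reaches_odd: "even (card {a \<in> E `` {v}. \<not> reaches_odd v a})"
proof -
  let ?T = "{x \<in> V - {v}. \<not> reaches_odd v x}"
  have "even (card (E `` {v} \<inter> ?T))"
  proof (rule even_card_boundary)
    show "y \<in> ?T" if "x \<in> ?T" "(x, y) \<in> E" "y \<noteq> v" for x y
      using that E_V[of x y] unfolding reaches_odd_def
      by (auto intro: converse_rtrancl_into_rtrancl)
    show "all_even E ?T"
      unfolding all_even_def reaches_odd_def by blast
  qed blast
  moreover have "E `` {v} \<inter> ?T = {a \<in> E `` {v}. \<not> reaches_odd v a}"
    using nbrs_subset[of v] E_irrefl by auto
  ultimately show ?thesis
    by simp
qed

text \<open>Cut a walk from \<open>v\<close> to \<open>w\<close> after its last visit to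
  \<open>v\<close>.\<close>

lemma ex_nbr_reaches_odd:
  assumes "(v, w) \<in> E\<^sup>*" "w \<noteq> v" "odd (deg E w)"
  shows "\<exists>a\<in>E `` {v}. reaches_odd v a"
proof -
  let ?Ev = "{(x, y) \<in> E. x \<noteq> v \<and> y \<noteq> v}"
  have "w = v \<or> (\<exists>a\<in>E `` {v}. (a, w) \<in> ?Ev\<^sup>*)"
    using assms(1)
  proof (induction rule: rtrancl_induct)
    case (step y z)
    show ?case
    proof (cases "y = v")
      case True
      with step.hyps(2) show ?thesis
        by auto
    next
      case False
      with step.hyps(2) have "z = v \<or> (y, z) \<in> ?Ev"
        by simp
      with step.IH False show ?thesis
        by (meson rtrancl.rtrancl_into_rtrancl)
    qed
  qed simp
  with assms(2,3) show ?thesis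
    unfolding reaches_odd_def by blast
qed

text \<open>Call a neighbour good if it reaches an odd vertex around \<open>v\<close>; the number of
  bad ones is even. For odd degree some neighbour is therefore good, and the copy that keeps the
  rest is itself odd. For even degree there are at least two good ones: \<open>a\<close> is cut off,
  \<open>c\<close> stays, and degree three supplies the companion \<open>b\<close> of
  \<open>a\<close>.\<close>

lemma obtain_split_nbrs:
  assumes "v \<in> V" "\<not> all_even E (component E v)" "3 \<le> deg E v"
  obtains a b where "a \<in> E `` {v}" "b \<in> E `` {v}" "a \<noteq> b" "reaches_odd v a"
    "odd (deg E v) \<or> (\<exists>c\<in>E `` {v} - {a, b}. reaches_odd v c)"
proof -
  let ?N = "E `` {v}"
  let ?good = "{a \<in> ?N. reaches_odd v a}" and ?bad = "{a \<in> ?N. \<not> reaches_odd v a}"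
  have fin: "finite ?good" "finite ?bad"
    using finite_nbrs[of v] by (rule finite_subset[rotated], blast)+
  have "?N = ?good \<union> ?bad" "?good \<inter> ?bad = {}"
    by blast+
  then have card: "deg E v = card ?good + card ?bad"
    using card_Un_disjoint[OF fin] by metis
  show thesis
  proof (cases "odd (deg E v)")
    case True
    then have "odd (card ?good)"
      using card even_card_not_reaches_odd[of v] by simp
    then have "?good \<noteq> {}"
      by (metis card.empty even_zero)
    then obtain a where a: "a \<in> ?N" "reaches_odd v a"
      by blast
    have "\<not> ?N \<subseteq> {a}"
      using assms(3) card_mono[of "{a}" ?N] by auto
    then obtain b where "b \<in> ?N" "b \<noteq> a"
      by blast
    then show thesis
      using a True by (intro that[of a b]) simp_all
  next
    case False
    obtain w where w: "(v, w) \<in> E\<^sup>*" "odd (deg E w)"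
      using assms(2) unfolding all_even_def by blast
    then have "w \<noteq> v"
      using False by blast
    then obtain a where a: "a \<in> ?N" "reaches_odd v a"
      using w ex_nbr_reaches_odd by blast
    have "even (card ?good)"
      using False card even_card_not_reaches_odd[of v] by simp
    \<comment> \<open>An even number of good neighbours cannot be one.\<close>
    then have "?good \<noteq> {a}"
      by (metis is_singletonI is_singleton_altdef odd_one)
    then obtain c where c: "c \<in> ?N" "reaches_odd v c" "c \<noteq> a"
      using a by blast
    have "\<not> ?N \<subseteq> {a, c}"
    proof
      assume "?N \<subseteq> {a, c}"
      then have "deg E v \<le> card {a, c}"
        by (rule card_mono[rotated]) simp
      also have "\<dots> \<le> 2"
        by (simp add: card_insert_if)
      finally show False
        using assms(3) by simp
    qed
    then obtain b where "b \<in> ?N" "b \<noteq> a" "b \<noteq> c"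
      by blast
    then show thesis
      using a c by (intro that[of a b]) auto
  qed
qed

text \<open>Neighbours are the adjacent positions, and a path with at least two vertices starts at a
  vertex of degree one, which is odd.\<close>

lemma path_on_deg:
  assumes "v \<in> V" "path_on E (component E v)"
  shows "deg E v \<le> 2" and "all_even E (component E v) \<Longrightarrow> deg E v = 0"
proof -
  obtain xs where xs: "xs \<noteq> []" "distinct xs" "component E v = set xs"
    and E: "E \<inter> component E v \<times> component E v = {(xs ! i, xs ! j) | i j.
       i < length xs \<and> j < length xs \<and> (j = Suc i \<or> i = Suc j)}"
    using assms(2) unfolding path_on_def by blast
  have nbrs: "E `` {xs ! i} = {xs ! j | j. j < length xs \<and> (j = Suc i \<or> i = Suc j)}"
    if "i < length xs" for i
  proof -
    have "xs ! i \<in> component E v"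
      using that xs(3) by simp
    then have "(xs ! i, y) \<in> E \<longleftrightarrow> (xs ! i, y) \<in> E \<inter> component E v \<times> component E v" for y
      using rtrancl_into_rtrancl[of v "xs ! i" E y] by auto
    moreover have "(xs ! i, y) \<in> {(xs ! i, xs ! j) | i j.
         i < length xs \<and> j < length xs \<and> (j = Suc i \<or> i = Suc j)} \<longleftrightarrow>
       (\<exists>j. y = xs ! j \<and> j < length xs \<and> (j = Suc i \<or> i = Suc j))" for y
      using that nth_eq_iff_index_eq[OF xs(2)] by blast
    ultimately show ?thesis
      unfolding E by blast
  qed
  obtain i where i: "i < length xs" "v = xs ! i"
    using xs(3) in_set_conv_nth[of v xs] by auto
  \<comment> \<open>Only an inclusion, since at an end of the path an index may be out of range or
    truncated back to \<open>i\<close>.\<close>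
  have "E `` {v} \<subseteq> {xs ! Suc i, xs ! (i - 1)}"
    using nbrs[OF i(1)] i(2) by auto
  then have "deg E v \<le> card {xs ! Suc i, xs ! (i - 1)}"
    by (rule card_mono[rotated]) simp
  also have "\<dots> \<le> 2"
    by (simp add: card_insert_if)
  finally show "deg E v \<le> 2" .
  assume even: "all_even E (component E v)"
  have "length xs = 1"
  proof (rule ccontr)
    assume "length xs \<noteq> 1"
    then have "2 \<le> length xs"
      using xs(1) by (cases xs; cases "tl xs") auto
    then have "E `` {xs ! 0} = {xs ! 1}"
      using nbrs[of 0] by force
    then have "odd (deg E (xs ! 0))"
      by simp
    moreover have "xs ! 0 \<in> component E v"
      using xs(1,3) by simp
    ultimately show False
      using even unfolding all_even_def by blast
  qed
  then show "deg E v = 0"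
    using nbrs[OF i(1)] i by (auto simp: deg_0_iff)
qed

text \<open>A longest path starting at a vertex of degree one cannot be left through any of its vertices.\<close>

lemma path_on_component_leaf:
  assumes "w \<in> V" "deg E w = 1" and deg_le: "\<And>x. x \<in> V \<Longrightarrow> deg E x \<le> 2"
  shows "path_on E (component E w)"
proof -
  define walk where "walk xs \<longleftrightarrow> xs \<noteq> [] \<and> xs ! 0 = w \<and> distinct xs \<and> set xs \<subseteq> V \<and>
    (\<forall>i. Suc i < length xs \<longrightarrow> (xs ! i, xs ! Suc i) \<in> E)" for xs
  have "walk [w]"
    using assms(1) by (simp add: walk_def)
  \<comment> \<open>A longest walk exists because its vertices are distinct elements of
    \<open>V\<close>.\<close>
  moreover have "length xs < Suc (card V)" if "walk xs" for xs
    using that distinct_card[of xs] card_mono[OF finite_V, of "set xs"] by (simp add: walk_def)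
  ultimately obtain xs where "walk xs" and max: "\<And>ys. walk ys \<Longrightarrow> length ys \<le> length xs"
    using ex_has_greatest_nat[of walk "[w]" length "Suc (card V)"] by blast
  then have xs: "xs \<noteq> []" "xs ! 0 = w" "distinct xs" "set xs \<subseteq> V"
    and edge: "\<And>i. Suc i < length xs \<Longrightarrow> (xs ! i, xs ! Suc i) \<in> E"
    by (auto simp: walk_def)
  let ?n = "length xs"
  \<comment> \<open>Otherwise \<open>y\<close> would extend a longest walk.\<close>
  have last: "y \<in> set xs" if "(xs ! (?n - 1), y) \<in> E" for y
  proof (rule ccontr)
    assume "y \<notin> set xs"
    have "walk (xs @ [y])"
      unfolding walk_def
    proof (intro conjI allI impI)
      show "((xs @ [y]) ! i, (xs @ [y]) ! Suc i) \<in> E" if "Suc i < length (xs @ [y])" for i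
      proof (cases "Suc i < ?n")
        case True
        then show ?thesis
          using edge by (simp add: nth_append)
      next
        case False
        then have "i = ?n - 1" "Suc i = ?n"
          using that by auto
        then show ?thesis
          using \<open>(xs ! (?n - 1), y) \<in> E\<close> xs(1) by (simp add: nth_append)
      qed
    qed (use xs \<open>y \<notin> set xs\<close> E_V[OF that] in \<open>auto simp: nth_append\<close>)
    from max[OF this] show False
      by simp
  qed
  \<comment> \<open>The degree bound is used up by the walk: one neighbour at the leaf
    \<open>w\<close>, two at every later position before the last.\<close>
  have inner: "y = xs ! Suc i \<or> 0 < i \<and> y = xs ! (i - 1)"
    if "Suc i < ?n" "(xs ! i, y) \<in> E" for i y
  proof (cases "i = 0")
    case True
    then have "{y, xs ! Suc i} \<subseteq> E `` {w}"
      using that edge[of i] xs(2) by auto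
    then have "card {y, xs ! Suc i} \<le> 1"
      using card_mono[OF finite_nbrs[of w]] assms(2) by metis
    then show ?thesis
      by (auto simp: card_insert_if split: if_splits)
  next
    case False
    then have "(xs ! i, xs ! (i - 1)) \<in> E"
      using that edge[of "i - 1"] E_sym by simp
    then have "{y, xs ! Suc i, xs ! (i - 1)} \<subseteq> E `` {xs ! i}"
      using that edge[of i] by auto
    then have "card {y, xs ! Suc i, xs ! (i - 1)} \<le> deg E (xs ! i)"
      by (rule card_mono[OF finite_nbrs])
    also have "\<dots> \<le> 2"
      using that xs(4) nth_mem[of i xs] by (intro deg_le) auto
    finally have "card {y, xs ! Suc i, xs ! (i - 1)} \<le> 2" .
    moreover have "xs ! Suc i \<noteq> xs ! (i - 1)"
      using that nth_eq_iff_index_eq[OF xs(3), of "Suc i" "i - 1"] by simp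
    ultimately show ?thesis
      using False by (auto simp: card_insert_if split: if_splits)
  qed
  have nbrs: "\<exists>j<?n. y = xs ! j \<and> (j = Suc i \<or> i = Suc j)" if "i < ?n" "(xs ! i, y) \<in> E" for i y
  proof (cases "Suc i < ?n")
    case True
    from inner[OF this that(2)] show ?thesis
    proof
      assume "y = xs ! Suc i"
      with True show ?thesis by blast
    next
      assume "0 < i \<and> y = xs ! (i - 1)"
      with that(1) show ?thesis by (intro exI[of _ "i - 1"]) simp
    qed
  next
    case False
    then have i: "i = ?n - 1"
      using that(1) by simp
    then have "y \<in> set xs"
      using last that(2) by blast
    then obtain j where j: "j < ?n" "y = xs ! j"
      by (auto simp: in_set_conv_nth)
    have "j \<noteq> i"
      using j that(2) E_irrefl by auto
    \<comment> \<open>The last vertex has no degree argument of its own, so the arc is read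
      backwards from the earlier position \<open>j\<close>, where \<open>inner\<close>
      applies.\<close>
    then have "Suc j < ?n"
      using i j(1) by simp
    moreover have "(xs ! j, xs ! i) \<in> E"
      using that(2) j(2) E_sym by simp
    ultimately have "xs ! i = xs ! Suc j \<or> xs ! i = xs ! (j - 1)"
      using inner by blast
    then have "i = Suc j \<or> i = j - 1"
      using nth_eq_iff_index_eq[OF xs(3), of i] that(1) \<open>Suc j < ?n\<close> by auto
    then have "i = Suc j"
      using i \<open>Suc j < ?n\<close> by auto
    with j show ?thesis by blast
  qed
  have "y \<in> set xs" if "(w, y) \<in> E\<^sup>*" for y
    using that
  proof (induction rule: rtrancl_induct)
    case base
    show ?case
      using nth_mem[of 0 xs] xs(1,2) by simp
  next
    case (step y z)
    then obtain i where "i < ?n" "y = xs ! i"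
      by (auto simp: in_set_conv_nth)
    then show ?case
      using nbrs[of i z] step.hyps(2) by auto
  qed
  moreover have "(w, xs ! i) \<in> E\<^sup>*" if "i < ?n" for i
    using that
  proof (induction i)
    case (Suc i)
    then show ?case
      using edge[of i] by (auto intro: rtrancl_into_rtrancl)
  qed (simp add: xs(2))
  ultimately have comp: "component E w = set xs"
    by (auto simp: in_set_conv_nth)
  have "(xs ! i, xs ! j) \<in> E" if "i < ?n" "j < ?n" "j = Suc i \<or> i = Suc j" for i j
    using that edge E_sym by auto
  then have "{(xs ! i, xs ! j) | i j. i < ?n \<and> j < ?n \<and> (j = Suc i \<or> i = Suc j)} \<subseteq>
      E \<inter> set xs \<times> set xs"
    by auto
  moreover have "E \<inter> set xs \<times> set xs \<subseteq>
      {(xs ! i, xs ! j) | i j. i < ?n \<and> j < ?n \<and> (j = Suc i \<or> i = Suc j)}"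
  proof
    fix e assume "e \<in> E \<inter> set xs \<times> set xs"
    then obtain i y where i: "i < ?n" "e = (xs ! i, y)" "(xs ! i, y) \<in> E"
      by (auto simp: in_set_conv_nth)
    then obtain j where "j < ?n" "y = xs ! j" "j = Suc i \<or> i = Suc j"
      using nbrs by blast
    with i show "e \<in> {(xs ! i, xs ! j) | i j. i < ?n \<and> j < ?n \<and> (j = Suc i \<or> i = Suc j)}"
      by blast
  qed
  ultimately show ?thesis
    unfolding path_on_def comp using xs(1,3) by blast
qed

text \<open>The second hypothesis rules out cycles. A component that is not a single vertex thus has
  an odd vertex, which the degree bound turns into a leaf to start from.\<close>

lemma path_on_component:
  assumes deg_le: "\<And>x. x \<in> V \<Longrightarrow> deg E x \<le> 2"
    and even: "\<And>x. x \<in> V \<Longrightarrow> all_even E (component E x) \<Longrightarrow> deg E x = 0"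
    and "v \<in> V"
  shows "path_on E (component E v)"
proof (cases "all_even E (component E v)")
  case True
  then have "component E v = {v}"
    using even assms(3) comp_deg_0 by blast
  then show ?thesis
    unfolding path_on_def using E_irrefl by (intro exI[of _ "[v]"]) auto
next
  case False
  then obtain w where w: "(v, w) \<in> E\<^sup>*" "odd (deg E w)"
    unfolding all_even_def by blast
  then have "w \<in> V"
    using comp_subset[OF assms(3)] by blast
  then have "deg E w \<le> 2"
    by (rule deg_le)
  then have "deg E w = 1"
    using w(2) by (metis One_nat_def even_zero le_SucE le_zero_eq numeral_2_eq_2 dvd_refl)
  then have "path_on E (component E w)"
    using path_on_component_leaf[OF \<open>w \<in> V\<close> _ deg_le] by blast
  moreover have "component E v = component E w"
    using w(1) comp_eq_iff by blast
  ultimately show ?thesis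
    by simp
qed

end

context graph_split
begin

lemma reaches_odd_split:
  assumes "x \<in> V" "x \<noteq> v" "reaches_odd v x"
  shows "\<exists>w. (x, w) \<in> E'\<^sup>* \<and> odd (deg E' w)"
proof -
  let ?Ev = "{(x, y) \<in> E. x \<noteq> v \<and> y \<noteq> v}"
  obtain w where w: "(x, w) \<in> ?Ev\<^sup>*" "odd (deg E w)"
    using assms(3) unfolding reaches_odd_def by blast
  from w(1) have "w \<in> V \<and> w \<noteq> v"
    using assms(1,2) by (induction rule: rtrancl_induct) (auto dest: E_V)
  moreover have "(x, w) \<in> E'\<^sup>*"
    using w(1) by (rule rtrancl_mono[THEN subsetD, rotated]) (auto simp: E'_def)
  ultimately show ?thesis
    using w(2) deg_old by auto
qed

text \<open>No even component arises: \<open>v1\<close> reaches an odd vertex through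
  \<open>a\<close>, and \<open>v2\<close> either has odd degree itself or reaches one through
  \<open>c\<close>.\<close>

lemma cost_split_reaches_odd:
  assumes "\<not> all_even E (component E v)" "card N1 = 2" "a \<in> N1" "reaches_odd v a"
    and "odd (deg E v) \<or> (\<exists>c\<in>N2. reaches_odd v c)"
  shows "cost V' E' = cost V E"
proof -
  have "a \<in> V" "a \<noteq> v" "(v1, a) \<in> E'"
    using N_subset(1) assms(3) by (auto simp: E'_def)
  then obtain x where x: "(v1, x) \<in> E'\<^sup>*" "odd (deg E' x)"
    using reaches_odd_split[OF _ _ assms(4)] converse_rtrancl_into_rtrancl by metis
  obtain y where y: "(v2, y) \<in> E'\<^sup>*" "odd (deg E' y)"
  proof (cases "odd (deg E v)")
    case True
    then have "odd (deg E' v2)"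
      using assms(2) unfolding card_N[symmetric] nbrs_v2 by simp
    then show thesis
      using that by blast
  next
    case False
    then obtain c where c: "c \<in> N2" "reaches_odd v c"
      using assms(5) by blast
    then have "c \<in> V" "c \<noteq> v" "(v2, c) \<in> E'"
      using N_subset(2) by (auto simp: E'_def)
    then show thesis
      using reaches_odd_split[OF _ _ c(2)] converse_rtrancl_into_rtrancl that by metis
  qed
  show ?thesis
    using new_even_empty[OF x y] by (rule cost_split_odd[OF assms(1,2)])
qed

end

text \<open>The parts \<open>N1\<close> and \<open>N2\<close> are fixed before the new vertices,
  whose existence depends on the type \<open>'a\<close>.\<close>

lemma (in simple_graph) obtain_free_split:
  assumes "\<not> (\<forall>v\<in>V. path_on E (component E v))"
  obtains v N1 N2 where "v \<in> V" "N1 \<union> N2 = E `` {v}" "N1 \<inter> N2 = {}"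
    "\<And>v1 v2. v1 \<notin> V \<Longrightarrow> v2 \<notin> V \<Longrightarrow> v1 \<noteq> v2 \<Longrightarrow>
      cost (graph_split.V' V v v1 v2) (graph_split.E' E v v1 v2 N1 N2) = cost V E"
proof -
  have split: "graph_split V E v v1 v2 N1 N2"
    if "v \<in> V" "v1 \<notin> V" "v2 \<notin> V" "v1 \<noteq> v2" "N1 \<union> N2 = E `` {v}" "N1 \<inter> N2 = {}"
    for v v1 v2 N1 N2
    using that by unfold_locales
  \<comment> \<open>The contrapositive of \<open>path_on_component\<close>; a vertex of large degree
    in an even component falls under the first case.\<close>
  consider v where "v \<in> V" "all_even E (component E v)" "deg E v \<noteq> 0"
    | v where "v \<in> V" "\<not> all_even E (component E v)" "3 \<le> deg E v"
    using assms path_on_component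
    by (metis le_0_eq not_less_eq_eq numeral_2_eq_2 numeral_3_eq_3 zero_neq_numeral)
  then show thesis
  proof cases
    case (1 v)
    then obtain a where "a \<in> E `` {v}"
      unfolding deg_0_iff by blast
    with 1 show thesis
      by (intro that[of v "{a}" "E `` {v} - {a}"] graph_split.cost_split_even[OF split]) auto
  next
    case (2 v)
    from obtain_split_nbrs[OF this] obtain a b where
      "a \<in> E `` {v}" "b \<in> E `` {v}" "a \<noteq> b" "reaches_odd v a"
      "odd (deg E v) \<or> (\<exists>c\<in>E `` {v} - {a, b}. reaches_odd v c)" .
    with 2 show thesis
      by (intro that[of v "{a, b}" "E `` {v} - {a, b}"]
          graph_split.cost_split_reaches_odd[OF split, where a = a]) auto
  qed
qed

section \<open>Transfer to graphs and the exact minimum\<close>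

lemma simple_graph_pair_graph:
  assumes "pair_graph G"
  shows "simple_graph (pverts G) (parcs G)"
proof -
  interpret pair_graph G by fact
  show ?thesis
  proof
    show "sym (parcs G)"
      using arcs_symmetric by (auto intro: symI)
    show "irrefl (parcs G)"
      using no_loops' by (auto simp: irrefl_def)
  qed (use pair_finite_verts in_arcsD1 in_arcsD2 in auto)
qed

lemma pair_graph_simple_graph:
  assumes "simple_graph V E" "pverts G = V" "parcs G = E"
  shows "pair_graph G"
proof -
  interpret simple_graph V E by fact
  show ?thesis
  proof
    show "symmetric (with_proj G)"
      using sym_E assms(3) by (simp add: symmetric_def)
  qed (use finite_V finite_E E_V E_irrefl assms(2,3) in auto)
qed

lemma path_graph_induce_iff:
  "path_graph (with_proj G \<restriction> C) \<longleftrightarrow> path_on (parcs G) C"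
proof -
  have "arcs (with_proj G \<restriction> C) = parcs G \<inter> C \<times> C"
    by (auto simp: induce_subgraph_def)
  then show ?thesis
    unfolding path_graph_def path_on_def by simp
qed

lemma linear_forest_iff:
  assumes "pair_graph G"
  shows "linear_forest G \<longleftrightarrow> (\<forall>v\<in>pverts G. path_on (parcs G) (component (parcs G) v))"
proof -
  interpret pair_graph G by fact
  interpret S: simple_graph "pverts G" "parcs G"
    using assms by (rule simple_graph_pair_graph)
  have "scc_of v = component (parcs G) v" if "v \<in> pverts G" for v
  proof
    show "scc_of v \<subseteq> component (parcs G) v"
      unfolding scc_of_def reachable_conv by blast
    show "component (parcs G) v \<subseteq> scc_of v"
      unfolding scc_of_def reachable_conv using that S.comp_subset[OF that] S.conn_sym by blast
  qed
  then have "scc_of ` pverts G = component (parcs G) ` pverts G"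
    by (rule image_cong[OF refl])
  then have "sccs = induce_subgraph (with_proj G) ` component (parcs G) ` pverts G"
    unfolding sccs_conv_sccs_verts sccs_verts_conv_scc_of by (rule arg_cong)
  then show ?thesis
    unfolding linear_forest_def by (simp only: ball_simps path_graph_induce_iff)
qed

abbreviation graph_cost :: "'a pair_pre_digraph \<Rightarrow> nat" where
  "graph_cost G \<equiv> cost (pverts G) (parcs G)"

lemma exclusive_split_cost:
  assumes "pair_graph G" "exclusive_split G H"
  shows "pair_graph H" "card (pverts H) = Suc (card (pverts G))" "graph_cost G \<le> graph_cost H"
proof -
  from assms(2) obtain v v1 v2 N1 N2 where
    *: "v \<in> pverts G" "v1 \<notin> pverts G" "v2 \<notin> pverts G" "v1 \<noteq> v2"
      "N1 \<union> N2 = nbrs G v" "N1 \<inter> N2 = {}"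
    and H: "pverts H = (pverts G - {v}) \<union> {v1, v2}"
      "parcs H = {(x, y) \<in> parcs G. x \<noteq> v \<and> y \<noteq> v}
        \<union> {v1} \<times> N1 \<union> N1 \<times> {v1} \<union> {v2} \<times> N2 \<union> N2 \<times> {v2}"
    by (cases rule: exclusive_split.cases) auto
  interpret simple_graph "pverts G" "parcs G"
    using assms(1) by (rule simple_graph_pair_graph)
  have "nbrs G v = parcs G `` {v}"
    by (auto simp: nbrs_def)
  then interpret graph_split "pverts G" "parcs G" v v1 v2 N1 N2
    using * by unfold_locales simp_all
  have H': "pverts H = V'" "parcs H = E'"
    using H by (simp_all add: V'_def E'_def)
  show "pair_graph H"
    using split.simple_graph_axioms H' by (rule pair_graph_simple_graph)
  show "card (pverts H) = Suc (card (pverts G))"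
    unfolding H' by (rule card_V')
  show "graph_cost G \<le> graph_cost H"
    unfolding H' by (rule cost_le_split)
qed

text \<open>The vertex count records the number of splits exactly, which turns a bound on the final
  vertex count into a bound on \<open>k\<close>.\<close>

lemma exclusive_splits_cost:
  assumes "(exclusive_split ^^ k) G H" "pair_graph G"
  shows "pair_graph H \<and> card (pverts H) = card (pverts G) + k \<and> graph_cost G \<le> graph_cost H"
  using assms
proof (induction k arbitrary: H)
  case (Suc k)
  then obtain F where "(exclusive_split ^^ k) G F" "exclusive_split F H"
    by auto
  then show ?case
    using Suc.IH[of F] Suc.prems(2) exclusive_split_cost[of F H] by simp
qed simp

lemma linear_forest_cost:
  assumes "pair_graph G" "linear_forest G"
  shows "graph_cost G \<le> card (pverts G)"
proof -
  interpret simple_graph "pverts G" "parcs G"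
    using assms(1) by (rule simple_graph_pair_graph)
  show ?thesis
    using assms linear_forest_iff path_on_deg by (intro cost_le_card) blast+
qed

lemma exclusive_split_free:
  fixes G :: "nat pair_pre_digraph"
  assumes "pair_graph G" "\<not> linear_forest G"
  obtains H where "exclusive_split G H" "graph_cost H = graph_cost G"
proof -
  interpret simple_graph "pverts G" "parcs G"
    using assms(1) by (rule simple_graph_pair_graph)
  obtain v N1 N2 where vN: "v \<in> pverts G" "N1 \<union> N2 = parcs G `` {v}" "N1 \<inter> N2 = {}"
    and cost: "\<And>v1 v2. v1 \<notin> pverts G \<Longrightarrow> v2 \<notin> pverts G \<Longrightarrow> v1 \<noteq> v2 \<Longrightarrow>
      cost (graph_split.V' (pverts G) v v1 v2) (graph_split.E' (parcs G) v v1 v2 N1 N2) = graph_cost G"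
    using assms linear_forest_iff obtain_free_split by metis
  \<comment> \<open>Infinitely many naturals lie outside the finite vertex set.\<close>
  obtain v1 where v1: "v1 \<notin> pverts G"
    using ex_new_if_finite[OF infinite_UNIV_nat finite_V] by blast
  obtain v2 where v2: "v2 \<notin> insert v1 (pverts G)"
    using ex_new_if_finite[OF infinite_UNIV_nat, of "insert v1 (pverts G)"] finite_V by blast
  interpret graph_split "pverts G" "parcs G" v v1 v2 N1 N2
    using vN v1 v2 by unfold_locales auto
  let ?H = "\<lparr>pverts = (pverts G - {v}) \<union> {v1, v2},
      parcs = {(x, y) \<in> parcs G. x \<noteq> v \<and> y \<noteq> v}
        \<union> {v1} \<times> N1 \<union> N1 \<times> {v1} \<union> {v2} \<times> N2 \<union> N2 \<times> {v2}\<rparr>"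
  have "nbrs G v = parcs G `` {v}"
    by (auto simp: nbrs_def)
  then have "exclusive_split G ?H"
    using vN v1 v2 by (intro exclusive_split.intros) simp_all
  moreover have "graph_cost ?H = graph_cost G"
    using cost[of v1 v2] v1 v2 unfolding V'_def E'_def by simp
  ultimately show thesis
    by (rule that)
qed

text \<open>A free split adds a vertex at unchanged cost, so the excess of the cost over the vertex
  count falls by exactly one.\<close>

lemma splits_to_linear_forest_cost:
  fixes G :: "nat pair_pre_digraph"
  assumes "pair_graph G"
  shows "splits_to_linear_forest G (graph_cost G - card (pverts G))"
  using assms
proof (induction "graph_cost G - card (pverts G)" arbitrary: G rule: less_induct)
  case less
  let ?k = "graph_cost G - card (pverts G)"
  show ?case
  proof (cases "linear_forest G")
    case True
    then have "?k = 0"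
      using linear_forest_cost[OF less.prems] by simp
    with True show ?thesis
      unfolding splits_to_linear_forest_def by (intro exI[of _ G]) simp
  next
    case False
    obtain H where H: "exclusive_split G H" "graph_cost H = graph_cost G"
      using exclusive_split_free[OF less.prems False] .
    note H' = exclusive_split_cost[OF less.prems H(1)]
    \<comment> \<open>This keeps the truncated subtraction exact.\<close>
    have "card (pverts H) \<le> graph_cost H"
      using simple_graph.card_le_cost[OF simple_graph_pair_graph[OF H'(1)]] .
    then have k: "?k = Suc (graph_cost H - card (pverts H))"
      using H'(2) H(2) by simp
    then have "splits_to_linear_forest H (graph_cost H - card (pverts H))"
      using H'(1) by (intro less.hyps) simp_all
    then show ?thesis
      unfolding splits_to_linear_forest_def k using relpowp_Suc_I2[of exclusive_split G H] H(1) by blast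
  qed
qed

text \<open>Lower bound: if \<open>j\<close> splits lead to a linear forest \<open>H\<close>, then
  cost of \<open>G\<close> \<le> cost of \<open>H\<close> \<le> vertices of \<open>H\<close> =
  vertices of \<open>G\<close> plus \<open>j\<close>.\<close>

lemma min_number_of_splits_cost:
  fixes G :: "nat pair_pre_digraph"
  assumes "pair_graph G"
  shows "min_number_of_splits G (graph_cost G - card (pverts G))"
  unfolding min_number_of_splits_def
proof (intro conjI allI impI splits_to_linear_forest_cost[OF assms])
  fix j assume "splits_to_linear_forest G j"
  then obtain H where H: "(exclusive_split ^^ j) G H" "linear_forest H"
    unfolding splits_to_linear_forest_def by blast
  note H' = exclusive_splits_cost[OF H(1) assms]
  moreover have "graph_cost H \<le> card (pverts H)"
    using H' H(2) linear_forest_cost by blast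
  ultimately show "graph_cost G - card (pverts G) \<le> j"
    by linarith
qed

section \<open>Program logic\<close>

text \<open>Jump targets are absolute, so code depends on the address at which it is placed.\<close>

type_synonym fragment = "nat \<Rightarrow> instr list"
type_synonym assertion = "(nat \<Rightarrow> nat) \<Rightarrow> (nat \<Rightarrow> nat) \<Rightarrow> bool"

definition code_at :: "instr list \<Rightarrow> nat \<Rightarrow> instr list \<Rightarrow> bool" where
  "code_at P l c \<longleftrightarrow> (\<exists>xs ys. P = xs @ c @ ys \<and> length xs = l)"

lemma code_at_append:
  "code_at P l (c @ d) \<longleftrightarrow> code_at P l c \<and> code_at P (l + length c) d" (is "?L \<longleftrightarrow> ?R")
proof
  assume ?L
  then obtain xs ys where "P = xs @ (c @ d) @ ys" "length xs = l"
    unfolding code_at_def by blast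
  then have "P = xs @ c @ (d @ ys) \<and> length xs = l"
    "P = (xs @ c) @ d @ ys \<and> length (xs @ c) = l + length c" by auto
  then show ?R
    unfolding code_at_def by blast
next
  assume ?R
  then obtain xs ys xs' ys' where *: "P = xs @ c @ ys" "length xs = l"
    "P = xs' @ d @ ys'" "length xs' = l + length c"
    unfolding code_at_def by blast
  then have "(xs @ c) @ ys = xs' @ d @ ys'" "length (xs @ c) = length xs'"
    by auto
  then have "ys = d @ ys'"
    using append_eq_append_conv by blast
  with * show ?L
    unfolding code_at_def by auto
qed

lemma code_at_Cons: "code_at P l (i # c) \<longleftrightarrow> code_at P l [i] \<and> code_at P (Suc l) c"
  using code_at_append[of P l "[i]" c] by simp

lemma step_code_at:
  assumes "code_at P l [i]" "pc s = l"
  shows "step P s = exec i s"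
proof -
  have "l < length P" "P ! l = i"
    using assms(1) unfolding code_at_def by (auto simp: nth_append)
  then show ?thesis
    using assms(2) by (simp add: step_def halted_def)
qed

text \<open>The machine is deterministic, so reaching \<open>l\<close> at one moment within the
  bound expresses total correctness together with the running time.\<close>

definition runs :: "instr list \<Rightarrow> nat \<Rightarrow> ram_state \<Rightarrow> nat \<Rightarrow> assertion \<Rightarrow> bool" where
  "runs P t s l R \<longleftrightarrow>
     (\<exists>t'\<le>t. pc ((step P ^^ t') s) = l \<and> R (reg ((step P ^^ t') s)) (mem ((step P ^^ t') s)))"

lemma runs_0: "pc s = l \<Longrightarrow> R (reg s) (mem s) \<Longrightarrow> runs P 0 s l R"
  by (simp add: runs_def)

lemma runs_mono:
  assumes "runs P t s l R" "t \<le> u" "\<And>r m. R r m \<Longrightarrow> S r m"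
  shows "runs P u s l S"
proof -
  obtain t' where "t' \<le> t" "pc ((step P ^^ t') s) = l"
    "R (reg ((step P ^^ t') s)) (mem ((step P ^^ t') s))"
    using assms(1) unfolding runs_def by blast
  then show ?thesis
    using assms(2,3) unfolding runs_def by (intro exI[of _ t']) auto
qed

lemma runs_trans:
  assumes "runs P t s l R"
    and "\<And>s'. pc s' = l \<Longrightarrow> R (reg s') (mem s') \<Longrightarrow> runs P u s' k S"
  shows "runs P (t + u) s k S"
proof -
  obtain t' where t': "t' \<le> t" "pc ((step P ^^ t') s) = l"
    "R (reg ((step P ^^ t') s)) (mem ((step P ^^ t') s))"
    using assms(1) unfolding runs_def by blast
  then obtain u' where "u' \<le> u" "pc ((step P ^^ u') ((step P ^^ t') s)) = k"
    "S (reg ((step P ^^ u') ((step P ^^ t') s))) (mem ((step P ^^ u') ((step P ^^ t') s)))"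
    using assms(2)[OF t'(2,3)] unfolding runs_def by blast
  then show ?thesis
    using t'(1) unfolding runs_def
    by (intro exI[of _ "u' + t'"]) (simp add: funpow_add)
qed

lemma runs_step:
  assumes "code_at P (pc s) [i]" "runs P t (exec i s) k S"
  shows "runs P (Suc t) s k S"
proof -
  obtain t' where "t' \<le> t" "pc ((step P ^^ t') (exec i s)) = k"
    "S (reg ((step P ^^ t') (exec i s))) (mem ((step P ^^ t') (exec i s)))"
    using assms(2) unfolding runs_def by blast
  then show ?thesis
    using step_code_at[OF assms(1) refl] unfolding runs_def
    by (intro exI[of _ "Suc t'"]) (simp add: funpow_Suc_right del: funpow.simps)
qed

text \<open>Quantifying over the surrounding program and the address makes triples independent of
  placement.\<close>

definition hoare :: "assertion \<Rightarrow> fragment \<Rightarrow> nat \<Rightarrow> assertion \<Rightarrow> bool" where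
  "hoare Q c t R \<longleftrightarrow> (\<forall>P l s. code_at P l (c l) \<longrightarrow> pc s = l \<longrightarrow> Q (reg s) (mem s) \<longrightarrow>
     runs P t s (l + length (c l)) R)"

lemma hoareI:
  assumes "\<And>P s. code_at P (pc s) (c (pc s)) \<Longrightarrow> Q (reg s) (mem s) \<Longrightarrow>
    runs P t s (pc s + length (c (pc s))) R"
  shows "hoare Q c t R"
  using assms unfolding hoare_def by blast

lemma hoareD:
  assumes "hoare Q c t R" "code_at P l (c l)" "pc s = l" "Q (reg s) (mem s)"
    "k = l + length (c l)"
  shows "runs P t s k R"
  using assms unfolding hoare_def by blast

lemma hoare_conseq:
  assumes "hoare Q c t R" "\<And>r m. Q' r m \<Longrightarrow> Q r m" "t \<le> t'" "\<And>r m. R r m \<Longrightarrow> R' r m"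
  shows "hoare Q' c t' R'"
  using assms runs_mono[of _ t _ _ R t' R'] unfolding hoare_def by blast

text \<open>Allows a labelling that the precondition merely asserts to exist to be fixed outside the
  triple.\<close>

lemma hoare_ex:
  assumes "\<And>x. hoare (Q x) c t R"
  shows "hoare (\<lambda>r m. \<exists>x. Q x r m) c t R"
  using assms unfolding hoare_def by blast

definition seq :: "fragment \<Rightarrow> fragment \<Rightarrow> fragment" (infixr ";;" 60) where
  "(c ;; d) l = c l @ d (l + length (c l))"

lemma hoare_seq:
  assumes "hoare Q c t R" "hoare R d u S"
  shows "hoare Q (c ;; d) (t + u) S"
proof (rule hoareI)
  fix P and s :: ram_state
  assume *: "code_at P (pc s) ((c ;; d) (pc s))" "Q (reg s) (mem s)"
  let ?l = "pc s + length (c (pc s))"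
  have code: "code_at P (pc s) (c (pc s))" "code_at P ?l (d ?l)"
    using *(1) by (simp_all add: seq_def code_at_append)
  show "runs P (t + u) s (pc s + length ((c ;; d) (pc s))) S"
  proof (rule runs_trans)
    show "runs P t s ?l R"
      using hoareD[OF assms(1) code(1)] *(2) by blast
    show "runs P u s' (pc s + length ((c ;; d) (pc s))) S"
      if "pc s' = ?l" "R (reg s') (mem s')" for s'
      using that by (intro hoareD[OF assms(2) code(2)]) (simp_all add: seq_def)
  qed
qed

text \<open>For straight-line code the program counter is predictable, so a block is a fold over
  registers and memory that simplification can evaluate.\<close>

fun effect :: "instr \<Rightarrow> (nat \<Rightarrow> nat) \<times> (nat \<Rightarrow> nat) \<Rightarrow> (nat \<Rightarrow> nat) \<times> (nat \<Rightarrow> nat)" where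
  "effect (LI i c) (r, m) = (r(i := c), m)"
| "effect (ADD i j k) (r, m) = (r(i := r j + r k), m)"
| "effect (SUB i j k) (r, m) = (r(i := r j - r k), m)"
| "effect (LD i j) (r, m) = (r(i := m (r j)), m)"
| "effect (ST i j) (r, m) = (r, m(r i := r j))"
| "effect (JNZ i l) (r, m) = (r, m)"

fun jump_free :: "instr list \<Rightarrow> bool" where
  "jump_free [] \<longleftrightarrow> True"
| "jump_free (JNZ i l # c) \<longleftrightarrow> False"
| "jump_free (i # c) \<longleftrightarrow> jump_free c"

definition block :: "instr list \<Rightarrow> fragment" where
  "block c l = c"

lemma runs_block:
  assumes "code_at P (pc s) c" "jump_free c"
    and "case_prod R (fold effect c (reg s, mem s))"
  shows "runs P (length c) s (pc s + length c) R"
  using assms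
proof (induction c arbitrary: s)
  case Nil
  then show ?case by (simp add: runs_0)
next
  case (Cons i c)
  let ?s = "exec i s"
  have pc: "pc ?s = Suc (pc s)"
    using Cons.prems(2) by (cases i) simp_all
  have eff: "effect i (reg s, mem s) = (reg ?s, mem ?s)"
    using Cons.prems(2) by (cases i) simp_all
  have jf: "jump_free c"
    using Cons.prems(2) by (cases i) simp_all
  have code: "code_at P (Suc (pc s)) c" "code_at P (pc s) [i]"
    using Cons.prems(1) code_at_Cons by blast+
  have "runs P (length c) ?s (pc ?s + length c) R"
  proof (rule Cons.IH)
    show "code_at P (pc ?s) c"
      unfolding pc by (rule code(1))
    show "case_prod R (fold effect c (reg ?s, mem ?s))"
      using Cons.prems(3) eff by (simp only: fold.simps o_apply)
  qed (rule jf)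
  then have "runs P (Suc (length c)) s (pc ?s + length c) R"
    by (rule runs_step[OF code(2)])
  then show ?case
    by (simp add: pc)
qed

lemma hoare_block:
  assumes "jump_free c" "\<And>r m. Q r m \<Longrightarrow> case_prod R (fold effect c (r, m))" "length c \<le> t"
  shows "hoare Q (block c) t R"
proof (rule hoareI)
  fix P and s :: ram_state
  assume *: "code_at P (pc s) (block c (pc s))" "Q (reg s) (mem s)"
  have "runs P (length c) s (pc s + length c) R"
    using *(1) unfolding block_def by (rule runs_block[OF _ assms(1) assms(2)[OF *(2)]])
  then show "runs P t s (pc s + length (block c (pc s))) R"
    unfolding block_def using assms(3) by (rule runs_mono)
qed

definition unless :: "nat \<Rightarrow> fragment \<Rightarrow> fragment" where
  "unless i c l = JNZ i (l + 1 + length (c (l + 1))) # c (l + 1)"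

lemma hoare_unless:
  assumes "hoare (\<lambda>r m. Q r m \<and> r i = 0) c t R" "\<And>r m. Q r m \<Longrightarrow> r i \<noteq> 0 \<Longrightarrow> R r m"
  shows "hoare Q (unless i c) (Suc t) R"
proof (rule hoareI)
  fix P and s :: ram_state
  assume *: "code_at P (pc s) (unless i c (pc s))" "Q (reg s) (mem s)"
  let ?l = "Suc (pc s)"
  let ?k = "?l + length (c ?l)"
  have j: "code_at P (pc s) [JNZ i ?k]" and c: "code_at P ?l (c ?l)"
    using *(1) code_at_append[of P "pc s" "[JNZ i ?k]" "c ?l"] by (simp_all add: unless_def)
  have "runs P t (exec (JNZ i ?k) s) ?k R"
  proof (cases "reg s i = 0")
    case True
    then show ?thesis
      using * by (intro hoareD[OF assms(1) c]) simp_all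
  next
    case False
    then have "runs P 0 (exec (JNZ i ?k) s) ?k R"
      using *(2) assms(2) by (intro runs_0) simp_all
    then show ?thesis
      by (rule runs_mono) simp_all
  qed
  then show "runs P (Suc t) s (pc s + length (unless i c (pc s))) R"
    using runs_step[OF j] by (simp add: unless_def)
qed

text \<open>
  The entry jump is unconditional only because register 1 holds the constant 1, which also
  serves as the decrement of the counter.
\<close>

definition loop :: "nat \<Rightarrow> fragment \<Rightarrow> fragment" where
  "loop i c l = (let n = length (c (l + 1)) in
     JNZ 1 (l + n + 2) # c (l + 1) @ [SUB i i 1, JNZ i (l + 1)])"

text \<open>\<open>k\<close> counts completed rounds. The body is followed by the decrement, hence
  the invariant after it is stated for the updated counter. Each round costs the body, the decrement
  and the test; the entry jump and the last test give the final 2.\<close>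

lemma hoare_loop:
  assumes body: "\<And>k. k < N \<Longrightarrow>
      hoare (\<lambda>r m. r i = N - k \<and> I k r m) c t
        (\<lambda>r m. r 1 = 1 \<and> r i = N - k \<and> I (Suc k) (r(i := N - Suc k)) m)"
    and one: "\<And>r m. I 0 r m \<Longrightarrow> r 1 = 1"
  shows "hoare (\<lambda>r m. r i = N \<and> I 0 r m) (loop i c) (N * (t + 2) + 2) (\<lambda>r m. r i = 0 \<and> I N r m)"
proof (rule hoareI)
  fix P and s :: ram_state
  assume code: "code_at P (pc s) (loop i c (pc s))" and pre: "reg s i = N \<and> I 0 (reg s) (mem s)"
  let ?l = "Suc (pc s)"
  let ?k = "?l + length (c ?l)"
  let ?R = "\<lambda>r m. r i = 0 \<and> I N r m"
  have code1: "code_at P (pc s) [JNZ 1 (Suc ?k)]" and code2: "code_at P ?l (c ?l)"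
    and code3: "code_at P ?k [SUB i i 1]" and code4: "code_at P (Suc ?k) [JNZ i ?l]"
    using code code_at_append[of P "pc s" "[JNZ 1 (Suc ?k)]" "c ?l @ [SUB i i 1, JNZ i ?l]"]
      code_at_append[of P ?k "[SUB i i 1]" "[JNZ i ?l]"]
      code_at_append[of P ?l "c ?l" "[SUB i i 1, JNZ i ?l]"]
    by (simp_all add: loop_def Let_def)
  \<comment> \<open>Started at the bottom test after \<open>k\<close> rounds; the induction is on
    the remaining rounds.\<close>
  have test: "runs P ((N - k) * (t + 2) + 1) s' (?k + 2) ?R"
    if "k \<le> N" "pc s' = Suc ?k" "reg s' i = N - k" "I k (reg s') (mem s')"
    for k and s' :: ram_state
    using that
  proof (induction "N - k" arbitrary: k s')
    case 0
    then have "runs P 0 (exec (JNZ i ?l) s') (?k + 2) ?R"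
      by (intro runs_0) simp_all
    then have "runs P (Suc 0) s' (?k + 2) ?R"
      using code4 0 by (intro runs_step[of P s' "JNZ i ?l"]) simp_all
    then show ?case
      using 0 by simp
  next
    case (Suc n)
    let ?S = "\<lambda>r m. r 1 = 1 \<and> r i = N - k \<and> I (Suc k) (r(i := N - Suc k)) m"
    have k: "k < N" "n = N - Suc k"
      using Suc.hyps(2) by auto
    have "runs P t (exec (JNZ i ?l) s') ?k ?S"
      using Suc k by (intro hoareD[OF body[OF k(1)] code2]) simp_all
    moreover have "runs P (Suc (n * (t + 2) + 1)) s'' (?k + 2) ?R"
      if s'': "pc s'' = ?k" "?S (reg s'') (mem s'')" for s''
    proof -
      have "runs P ((N - Suc k) * (t + 2) + 1) (exec (SUB i i 1) s'') (?k + 2) ?R"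
        using s'' k by (intro Suc.hyps(1)) simp_all
      then show ?thesis
        using code3 s'' k by (intro runs_step[of P s'' "SUB i i 1"]) simp_all
    qed
    ultimately have "runs P (t + Suc (n * (t + 2) + 1)) (exec (JNZ i ?l) s') (?k + 2) ?R"
      by (rule runs_trans)
    then have "runs P (Suc (t + Suc (n * (t + 2) + 1))) s' (?k + 2) ?R"
      using code4 Suc.prems by (intro runs_step[of P s' "JNZ i ?l"]) simp_all
    moreover have "(N - k) * (t + 2) + 1 = Suc (t + Suc (n * (t + 2) + 1))"
      using Suc.hyps(2)[symmetric] by simp
    ultimately show ?case
      by metis
  qed
  have "runs P (N * (t + 2) + 1) (exec (JNZ 1 (Suc ?k)) s) (?k + 2) ?R"
    using test[of 0 "exec (JNZ 1 (Suc ?k)) s"] pre one[of "reg s" "mem s"] by simp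
  then have "runs P (Suc (N * (t + 2) + 1)) s (?k + 2) ?R"
    using code1 by (intro runs_step[of P s "JNZ 1 (Suc ?k)"]) simp_all
  then show "runs P (N * (t + 2) + 2) s (pc s + length (loop i c (pc s))) ?R"
    by (simp add: loop_def Let_def)
qed

section \<open>The program\<close>

lemma hoare_time:
  assumes "hoare Q c t R" "t \<le> t'"
  shows "hoare Q c t' R"
  using hoare_conseq[OF assms(1) _ assms(2)] by blast

text \<open>
  The matrix is followed in memory by an array of labels, starting at address \<open>1 + n * n\<close>: one for
  each vertex and one for an extra vertex with index \<open>n\<close>, which is linked to all odd vertices so
  that the components with odd vertices fall into a single class. A label is the address of
  the label of a vertex of the same class.

  Registers 1 and 20 hold 1 and 0, register 2 holds \<open>n\<close>, registers 3 and 16 the addresses of the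
  first and the last label; 4, 5 and 6 are loop counters, 8 points into the matrix and
  9, 10 and 11 point into the labels. During the row scan register 12 is the parity of the row
  so far. As subtraction truncates, \<open>(a - b) + (b - a)\<close> is the distance, and for bits the
  exclusive or; \<open>1 - a\<close> tests for zero.
\<close>

definition address_setup :: fragment where
  "address_setup =
     block [LI 1 1, LD 2 0, LI 3 1, ADD 4 2 20] ;;
     loop 4 (block [ADD 3 3 2]) ;;
     block [ADD 16 3 2, LI 8 1, ADD 9 3 20, ADD 4 2 20]"

text \<open>For an entry a and parity p, truncation makes a - p equal to 1 exactly when a = 1 and p
  = 0, which is when the rounded-up half of the row sum grows.\<close>

definition row_entry :: fragment where
  "row_entry = block [LD 13 8, SUB 14 13 12, SUB 12 12 13, ADD 12 12 14, ADD 0 0 14, ADD 8 8 1]"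

text \<open>The address of the extra label is the default; an even row replaces it by the vertex's
  own label address.\<close>

definition row_scan :: fragment where
  "row_scan =
     block [LI 12 0, ADD 5 2 20] ;;
     loop 5 row_entry ;;
     block [ADD 13 16 20] ;;
     unless 12 (block [ADD 13 9 20]) ;;
     block [ST 9 13, ADD 9 9 1]"

text \<open>Register 7 vanishes exactly when the matrix entry is 1 and the label equals the one in
  register 14.\<close>

definition relabel_vertex :: fragment where
  "relabel_vertex =
     block [LD 21 11, SUB 7 21 14, SUB 22 14 21, ADD 7 7 22, ADD 7 7 12] ;;
     unless 7 (block [ST 11 13]) ;;
     block [ADD 11 11 1]"

text \<open>Both labels are copied to registers first because the pass may overwrite the label of
  the column vertex itself. It takes \<open>n + 1\<close> rounds to include the extra
  vertex.\<close>

definition merge_entry :: fragment where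
  "merge_entry =
     block [LD 12 8, LD 13 9, LD 14 10, SUB 12 1 12, ADD 11 3 20, ADD 6 2 1] ;;
     loop 6 relabel_vertex ;;
     block [ADD 8 8 1, ADD 10 10 1]"

definition merge_row :: fragment where
  "merge_row =
     block [ADD 10 3 20, ADD 5 2 20] ;;
     loop 5 merge_entry ;;
     block [ADD 9 9 1]"

text \<open>A class is counted at its representative, the one vertex whose label is its own
  address.\<close>

definition count_label :: fragment where
  "count_label = block [LD 21 9, SUB 7 21 9, SUB 22 9 21, ADD 7 7 22, SUB 7 1 7, ADD 0 0 7, ADD 9 9 1]"

text \<open>\<open>ST 16 16\<close> makes the extra vertex its own representative. The last block
  subtracts \<open>n\<close> for the vertices and 1 for the class of the extra vertex.\<close>

definition program :: fragment where
  "program =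
     address_setup ;;
     loop 4 row_scan ;;
     block [ST 16 16, LI 8 1, ADD 9 3 20, ADD 4 2 20] ;;
     loop 4 merge_row ;;
     block [ADD 9 3 20, ADD 4 2 1] ;;
     loop 4 count_label ;;
     block [SUB 0 0 2, SUB 0 0 1]"

text \<open>The fibres of \<open>cl\<close> are the classes generated by the arcs and the links from
  odd vertices to \<open>n\<close>: \<open>cl\<close> is constant along both, and by
  \<open>cl_finest\<close> every labelling with this property is constant on its fibres.\<close>

locale matrix_input =
  fixes n :: nat and A :: "nat \<Rightarrow> nat \<Rightarrow> nat" and M :: "nat \<Rightarrow> nat" and cl :: "nat \<Rightarrow> 'c"
  assumes size: "M 0 = n"
    and entry: "u < n \<Longrightarrow> v < n \<Longrightarrow> M (1 + u * n + v) = A u v"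
    and A_le: "A u v \<le> 1"
    and cl_arc: "u < n \<Longrightarrow> v < n \<Longrightarrow> A u v = 1 \<Longrightarrow> cl u = cl v"
    and cl_odd: "u < n \<Longrightarrow> odd (\<Sum>v<n. A u v) \<Longrightarrow> cl u = cl n"
    and cl_finest: "\<And>L :: nat \<Rightarrow> nat.
      (\<And>u v. u < n \<Longrightarrow> v < n \<Longrightarrow> A u v = 1 \<Longrightarrow> L u = L v) \<Longrightarrow>
      (\<And>u. u < n \<Longrightarrow> odd (\<Sum>v<n. A u v) \<Longrightarrow> L u = L n) \<Longrightarrow>
      x \<le> n \<Longrightarrow> y \<le> n \<Longrightarrow> cl x = cl y \<Longrightarrow> L x = L y"
begin

definition base :: nat where
  "base = 1 + n * n"

definition rowsum :: "nat \<Rightarrow> nat \<Rightarrow> nat" where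
  "rowsum u j = (\<Sum>v<j. A u v)"

definition halves :: "nat \<Rightarrow> nat" where
  "halves k = (\<Sum>u<k. (rowsum u n + 1) div 2)"

definition first_label :: "nat \<Rightarrow> nat" where
  "first_label x = (if x < n \<and> odd (rowsum x n) then n else x)"

text \<open>The invariant in row-major order: labels are representatives inside the right class, and
  all links processed so far are respected.\<close>

definition merged :: "nat \<Rightarrow> nat \<Rightarrow> (nat \<Rightarrow> nat) \<Rightarrow> bool" where
  "merged k j L \<longleftrightarrow>
     (\<forall>x\<le>n. L x \<le> n \<and> L (L x) = L x \<and> cl (L x) = cl x) \<and>
     (\<forall>x<n. odd (rowsum x n) \<longrightarrow> L x = L n) \<and>
     (\<forall>u<n. \<forall>v<n. (u < k \<or> u = k \<and> v < j) \<longrightarrow> A u v = 1 \<longrightarrow> L u = L v)"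

text \<open>A union step of the quick-find structure for disjoint sets.\<close>

definition relabel :: "nat \<Rightarrow> nat \<Rightarrow> (nat \<Rightarrow> nat) \<Rightarrow> nat \<Rightarrow> nat" where
  "relabel k j L x = (if A k j = 1 \<and> L x = L j then L k else L x)"

definition common :: assertion where
  "common r m \<longleftrightarrow> r 1 = 1 \<and> r 2 = n \<and> r 3 = base \<and> r 16 = base + n \<and> r 20 = 0 \<and> (\<forall>a<base. m a = M a)"

definition labels :: "nat \<Rightarrow> (nat \<Rightarrow> nat) \<Rightarrow> (nat \<Rightarrow> nat) \<Rightarrow> bool" where
  "labels k L m \<longleftrightarrow> (\<forall>x<k. m (base + x) = base + L x)"

lemma entry_base:
  assumes "u < n" "v < n"
  shows "Suc (u * n + v) < base"
proof -
  have "u * n + v < Suc u * n"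
    using assms by simp
  also have "\<dots> \<le> n * n"
    using assms by (intro mult_le_mono1) simp
  finally show ?thesis
    by (simp add: base_def)
qed

lemma A_cases: "A u v = 0 \<or> A u v = 1"
  using A_le[of u v] by linarith

lemma merged_first_label: "merged 0 0 first_label"
  using cl_odd by (auto simp: merged_def first_label_def rowsum_def)

lemma merged_next_row: "merged k n L \<Longrightarrow> merged (Suc k) 0 L"
  by (auto simp: merged_def less_Suc_eq)

text \<open>A whole label class is renamed to the representative \<open>L k\<close>, so equal labels
  stay equal and \<open>L k\<close> remains fixed; the arc guarantees that no two classes of
  \<open>cl\<close> are mixed.\<close>

lemma merged_relabel:
  assumes L: "merged k j L" and "k < n" "j < n"
  shows "merged k (Suc j) (relabel k j L)"
proof (cases "A k j = 1")
  case True
  let ?L = "relabel k j L"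
  have L1: "L x \<le> n" "L (L x) = L x" "cl (L x) = cl x" if "x \<le> n" for x
    using L that unfolding merged_def by auto
  have L2: "L x = L n" if "x < n" "odd (rowsum x n)" for x
    using L that unfolding merged_def by blast
  have L3: "L u = L v" if "u < n" "v < n" "u < k \<or> u = k \<and> v < j" "A u v = 1" for u v
    using L that unfolding merged_def by blast
  have relabel: "?L x = (if L x = L j then L k else L x)" for x
    using True by (simp add: relabel_def)
  have "cl (L k) = cl (L j)"
    using L1(3)[of k] L1(3)[of j] cl_arc[OF assms(2,3) True] assms(2,3) by simp
  then have "?L x \<le> n \<and> ?L (?L x) = ?L x \<and> cl (?L x) = cl x" if "x \<le> n" for x
    using L1[OF that] L1(1,2)[of k] assms(2) by (simp add: relabel) metis
  moreover have "?L x = ?L n" if "x < n" "odd (rowsum x n)" for x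
    using L2[OF that] by (simp add: relabel)
  moreover have "?L u = ?L v"
    if "u < n" "v < n" "u < k \<or> u = k \<and> v < Suc j" "A u v = 1" for u v
  proof (cases "u = k \<and> v = j")
    case False
    then have "L u = L v"
      using that by (intro L3) auto
    then show ?thesis
      by (simp add: relabel)
  qed (simp add: relabel)
  ultimately show ?thesis
    unfolding merged_def by blast
next
  case False
  then have "relabel k j L = L"
    by (simp add: relabel_def fun_eq_iff)
  moreover have "v < j" if "v < Suc j" "A k v = 1" for v
    using that False less_antisym by blast
  ultimately show ?thesis
    using L unfolding merged_def by metis
qed

text \<open>Once all arcs are processed, \<open>cl_finest\<close> makes \<open>L\<close> constant on
  each class, so the label \<open>L x\<close> is the only fixed point in the class of
  \<open>x\<close>.\<close>

lemma card_fixpoints_merged: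
  assumes "merged n 0 L"
  shows "card {x. x \<le> n \<and> L x = x} = card (cl ` {..n})"
proof -
  let ?F = "{x. x \<le> n \<and> L x = x}"
  have L: "L x \<le> n" "L (L x) = L x" "cl (L x) = cl x" if "x \<le> n" for x
    using assms that unfolding merged_def by auto
  have "L x = L y" if "x \<le> n" "y \<le> n" "cl x = cl y" for x y
  proof (rule cl_finest[where L = L])
    show "L u = L v" if "u < n" "v < n" "A u v = 1" for u v
      using assms that unfolding merged_def by blast
    show "L u = L n" if "u < n" "odd (\<Sum>v<n. A u v)" for u
      using assms that unfolding merged_def rowsum_def by blast
  qed (fact that)+
  then have "inj_on cl ?F"
    unfolding inj_on_def by simp metis
  moreover have "cl ` ?F = cl ` {..n}"
  proof
    show "cl ` {..n} \<subseteq> cl ` ?F"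
    proof
      fix c assume "c \<in> cl ` {..n}"
      then obtain x where "x \<le> n" "c = cl x"
        by blast
      then have "c = cl (L x) \<and> L x \<in> ?F"
        using L by simp
      then show "c \<in> cl ` ?F"
        by blast
    qed
  qed auto
  ultimately show ?thesis
    using card_image[of cl ?F] by simp
qed

section \<open>Correctness and running time of the fragments\<close>

lemma hoare_address_setup:
  "hoare (\<lambda>r m. r = (\<lambda>_. 0) \<and> m = M) address_setup (3 * n + 10)
     (\<lambda>r m. r 4 = n \<and> common r m \<and> r 8 = 1 \<and> r 9 = base \<and> r 0 = 0)"
proof -
  \<comment> \<open>The product \<open>n * n\<close> is formed by adding \<open>n\<close>
    repeatedly.\<close>
  define I :: "nat \<Rightarrow> assertion" where
    "I k r m \<longleftrightarrow> r 1 = 1 \<and> r 2 = n \<and> r 3 = 1 + k * n \<and> r 20 = 0 \<and> r 0 = 0 \<and> m = M" for k r m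
  have h2: "hoare (\<lambda>r m. r 4 = n \<and> I 0 r m) (loop 4 (block [ADD 3 3 2])) (n * (1 + 2) + 2)
      (\<lambda>r m. r 4 = 0 \<and> I n r m)"
    by (rule hoare_loop[where I = I]; (rule hoare_block)?) (auto simp: I_def)
  have h1: "hoare (\<lambda>r m. r = (\<lambda>_. 0) \<and> m = M) (block [LI 1 1, LD 2 0, LI 3 1, ADD 4 2 20]) 4
      (\<lambda>r m. r 4 = n \<and> I 0 r m)"
    by (rule hoare_block) (auto simp: I_def size)
  have h3: "hoare (\<lambda>r m. r 4 = 0 \<and> I n r m) (block [ADD 16 3 2, LI 8 1, ADD 9 3 20, ADD 4 2 20]) 4
      (\<lambda>r m. r 4 = n \<and> common r m \<and> r 8 = 1 \<and> r 9 = base \<and> r 0 = 0)"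
    by (rule hoare_block) (auto simp: I_def common_def base_def)
  show ?thesis
    unfolding address_setup_def by (rule hoare_time[OF hoare_seq[OF h1 hoare_seq[OF h2 h3]]]) simp
qed

lemma hoare_row_entry:
  assumes "k < n" "j < n"
  shows "hoare (\<lambda>r m. common r m \<and> labels k first_label m \<and> r 4 = n - k \<and> r 5 = n - j \<and>
      r 8 = Suc (k * n + j) \<and> r 9 = base + k \<and> r 12 = rowsum k j mod 2 \<and>
      r 0 = halves k + (rowsum k j + 1) div 2)
    row_entry 6
    (\<lambda>r m. common r m \<and> labels k first_label m \<and> r 4 = n - k \<and> r 5 = n - j \<and>
      r 8 = Suc (k * n + Suc j) \<and> r 9 = base + k \<and> r 12 = rowsum k (Suc j) mod 2 \<and>
      r 0 = halves k + (rowsum k (Suc j) + 1) div 2)"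
proof -
  have Suc: "rowsum k (Suc j) = rowsum k j + A k j"
    by (simp add: rowsum_def)
  have M: "Suc (k * n + j) < base" "M (Suc (k * n + j)) = A k j"
    using entry_base entry assms by simp_all
  \<comment> \<open>Exclusive or with the bit \<open>a\<close>, and the increment of the rounded-up
    half, in truncated arithmetic.\<close>
  have parity: "x mod 2 - a + (a - x mod 2) = (x + a) mod 2"
    "Suc x div 2 + (a - x mod 2) = Suc (x + a) div 2" if "a = 0 \<or> a = 1" for x a :: nat
    using that by (cases "even x"; auto elim!: evenE oddE)+
  show ?thesis
    unfolding row_entry_def
    by (rule hoare_block)
       (simp_all add: common_def M Suc parity[OF A_cases])
qed

lemma hoare_row_scan:
  assumes "k < n"
  shows "hoare (\<lambda>r m. r 4 = n - k \<and> common r m \<and> labels k first_label m \<and>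
      r 8 = Suc (k * n) \<and> r 9 = base + k \<and> r 0 = halves k)
    row_scan (8 * n + 9)
    (\<lambda>r m. r 4 = n - k \<and> common r m \<and> labels (Suc k) first_label m \<and>
      r 8 = Suc (Suc k * n) \<and> r 9 = base + Suc k \<and> r 0 = halves (Suc k))"
proof -
  define I where "I j r m \<longleftrightarrow> common r m \<and> labels k first_label m \<and> r 4 = n - k \<and>
      r 8 = Suc (k * n + j) \<and> r 9 = base + k \<and> r 12 = rowsum k j mod 2 \<and>
      r 0 = halves k + (rowsum k j + 1) div 2" for j and r m :: "nat \<Rightarrow> nat"
  define J where "J r m \<longleftrightarrow> common r m \<and> labels k first_label m \<and> r 4 = n - k \<and>
      r 8 = Suc (k * n + n) \<and> r 9 = base + k \<and> r 0 = halves (Suc k)" for r m :: "nat \<Rightarrow> nat"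
  have h1: "hoare (\<lambda>r m. r 4 = n - k \<and> common r m \<and> labels k first_label m \<and>
      r 8 = Suc (k * n) \<and> r 9 = base + k \<and> r 0 = halves k)
    (block [LI 12 0, ADD 5 2 20]) 2 (\<lambda>r m. r 5 = n \<and> I 0 r m)"
    by (rule hoare_block) (auto simp: I_def common_def rowsum_def)
  have h2: "hoare (\<lambda>r m. r 5 = n \<and> I 0 r m) (loop 5 row_entry) (n * (6 + 2) + 2)
    (\<lambda>r m. r 5 = 0 \<and> I n r m)"
  proof (rule hoare_loop[where I = I])
    show "hoare (\<lambda>r m. r 5 = n - j \<and> I j r m) row_entry 6
        (\<lambda>r m. r 1 = 1 \<and> r 5 = n - j \<and> I (Suc j) (r(5 := n - Suc j)) m)" if "j < n" for j
      using hoare_row_entry[OF assms that]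
      by (rule hoare_conseq) (auto simp: I_def common_def)
  qed (simp add: I_def common_def)
  have h3: "hoare (\<lambda>r m. r 5 = 0 \<and> I n r m) (block [ADD 13 16 20]) 1
      (\<lambda>r m. J r m \<and> r 12 = rowsum k n mod 2 \<and> r 13 = base + n)"
    by (rule hoare_block) (auto simp: I_def J_def common_def halves_def)
  have h4: "hoare (\<lambda>r m. J r m \<and> r 12 = rowsum k n mod 2 \<and> r 13 = base + n)
      (unless 12 (block [ADD 13 9 20])) (Suc 1) (\<lambda>r m. J r m \<and> r 13 = base + first_label k)"
    using assms
    by (intro hoare_unless hoare_block)
       (auto simp: J_def common_def first_label_def odd_iff_mod_2_eq_one)
  have h5: "hoare (\<lambda>r m. J r m \<and> r 13 = base + first_label k) (block [ST 9 13, ADD 9 9 1]) 2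
     (\<lambda>r m. r 4 = n - k \<and> common r m \<and> labels (Suc k) first_label m \<and>
      r 8 = Suc (Suc k * n) \<and> r 9 = base + Suc k \<and> r 0 = halves (Suc k))"
    by (rule hoare_block) (auto simp: J_def common_def labels_def less_Suc_eq)
  show ?thesis
    unfolding row_scan_def
    by (rule hoare_time[OF hoare_seq[OF h1 hoare_seq[OF h2 hoare_seq[OF h3 hoare_seq[OF h4 h5]]]]]) simp
qed

text \<open>The function \<open>f\<close> is a frame: it carries the values of the outer counters
  and pointers through the step. In the middle of a pass, labels below \<open>i\<close> are new and
  the others old.\<close>

lemma hoare_relabel_vertex:
  assumes "k < n" "j < n" "i \<le> n"
  shows "hoare (\<lambda>r m. common r m \<and> r 11 = base + i \<and> r 12 = 1 - A k j \<and>
      r 13 = base + L k \<and> r 14 = base + L j \<and>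
      (\<forall>x\<le>n. m (base + x) = base + (if x < i then relabel k j L x else L x)) \<and>
      (\<forall>y\<in>{0, 4, 5, 6, 8, 9, 10}. r y = f y))
    relabel_vertex 8
    (\<lambda>r m. common r m \<and> r 11 = base + Suc i \<and> r 12 = 1 - A k j \<and>
      r 13 = base + L k \<and> r 14 = base + L j \<and>
      (\<forall>x\<le>n. m (base + x) = base + (if x < Suc i then relabel k j L x else L x)) \<and>
      (\<forall>y\<in>{0, 4, 5, 6, 8, 9, 10}. r y = f y))"
proof -
  define I where "I r m \<longleftrightarrow> common r m \<and> r 11 = base + i \<and> r 12 = 1 - A k j \<and>
      r 13 = base + L k \<and> r 14 = base + L j \<and> (\<forall>y\<in>{0, 4, 5, 6, 8, 9, 10}. r y = f y)"
    for r m :: "nat \<Rightarrow> nat"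
  define lab where "lab z m \<longleftrightarrow>
      (\<forall>x\<le>n. m (base + x) = base + (if x < z then relabel k j L x else L x))" for z m
  have h1: "hoare (\<lambda>r m. I r m \<and> lab i m)
      (block [LD 21 11, SUB 7 21 14, SUB 22 14 21, ADD 7 7 22, ADD 7 7 12]) 5
      (\<lambda>r m. I r m \<and> lab i m \<and> r 7 = (L i - L j) + (L j - L i) + (1 - A k j))"
    using assms(3) by (intro hoare_block) (simp_all add: I_def common_def lab_def)
  have h2: "hoare (\<lambda>r m. I r m \<and> lab i m \<and> r 7 = (L i - L j) + (L j - L i) + (1 - A k j))
      (unless 7 (block [ST 11 13])) 2 (\<lambda>r m. I r m \<and> lab (Suc i) m)"
  proof (rule hoare_time[OF hoare_unless[OF hoare_block[where t = 1]]])
    fix r m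
    assume *: "(I r m \<and> lab i m \<and> r 7 = (L i - L j) + (L j - L i) + (1 - A k j)) \<and> r 7 = 0"
    then have "L i = L j" "A k j = 1"
      using A_cases[of k j] by auto
    then show "case_prod (\<lambda>r m. I r m \<and> lab (Suc i) m) (fold effect [ST 11 13] (r, m))"
      using * by (auto simp: I_def common_def lab_def relabel_def less_Suc_eq)
  next
    fix r m
    assume *: "I r m \<and> lab i m \<and> r 7 = (L i - L j) + (L j - L i) + (1 - A k j)" "r 7 \<noteq> 0"
    then have "relabel k j L i = L i"
      by (auto simp: relabel_def)
    then show "I r m \<and> lab (Suc i) m"
      using * by (auto simp: lab_def less_Suc_eq)
  qed simp_all
  have h3: "hoare (\<lambda>r m. I r m \<and> lab (Suc i) m) (block [ADD 11 11 1]) 1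
     (\<lambda>r m. I (r(11 := r 11 - 1)) m \<and> lab (Suc i) m \<and> r 11 = base + Suc i)"
    by (intro hoare_block) (simp_all add: I_def common_def)
  show ?thesis
    unfolding relabel_vertex_def
    by (rule hoare_conseq[OF hoare_seq[OF h1 hoare_seq[OF h2 h3]]])
       (simp_all add: I_def common_def lab_def)
qed

definition scanning :: "nat \<Rightarrow> nat \<Rightarrow> assertion" where
  "scanning k j r m \<longleftrightarrow> common r m \<and> r 0 = halves n \<and> r 8 = Suc (k * n + j) \<and> r 9 = base + k \<and>
     (\<exists>L. merged k j L \<and> labels (Suc n) L m)"

lemma hoare_merge_entry:
  assumes "k < n" "j < n"
  shows "hoare (\<lambda>r m. scanning k j r m \<and> r 4 = n - k \<and> r 5 = n - j \<and> r 10 = base + j)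
    merge_entry (10 * n + 20)
    (\<lambda>r m. scanning k (Suc j) r m \<and> r 4 = n - k \<and> r 5 = n - j \<and> r 10 = base + Suc j)"
proof -
  have M: "Suc (k * n + j) < base" "M (Suc (k * n + j)) = A k j"
    using entry_base entry assms by simp_all
  define S where "S r m \<longleftrightarrow> common r m \<and> r 0 = halves n \<and> r 8 = Suc (k * n + j) \<and>
    r 9 = base + k \<and> r 4 = n - k \<and> r 5 = n - j \<and> r 10 = base + j" for r m :: "nat \<Rightarrow> nat"
  \<comment> \<open>The labelling is fixed first and quantified again by \<open>hoare_ex\<close>; if
    it is not \<open>merged\<close>, the precondition is false.\<close>
  have "hoare (\<lambda>r m. S r m \<and> merged k j L \<and> labels (Suc n) L m) merge_entry (10 * n + 20)
    (\<lambda>r m. scanning k (Suc j) r m \<and> r 4 = n - k \<and> r 5 = n - j \<and> r 10 = base + Suc j)" for L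
  proof (cases "merged k j L")
    case True
    define I where "I i r m \<longleftrightarrow> S r m \<and> r 11 = base + i \<and> r 12 = 1 - A k j \<and>
      r 13 = base + L k \<and> r 14 = base + L j \<and>
      (\<forall>x\<le>n. m (base + x) = base + (if x < i then relabel k j L x else L x))"
      for i and r m :: "nat \<Rightarrow> nat"
    have h1: "hoare (\<lambda>r m. S r m \<and> merged k j L \<and> labels (Suc n) L m)
        (block [LD 12 8, LD 13 9, LD 14 10, SUB 12 1 12, ADD 11 3 20, ADD 6 2 1]) 6
        (\<lambda>r m. r 6 = Suc n \<and> I 0 r m)"
      using assms by (intro hoare_block) (simp_all add: S_def I_def common_def labels_def M less_Suc_eq_le)
    have h2: "hoare (\<lambda>r m. r 6 = Suc n \<and> I 0 r m) (loop 6 relabel_vertex) (Suc n * (8 + 2) + 2)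
        (\<lambda>r m. r 6 = 0 \<and> I (Suc n) r m)"
    proof (rule hoare_loop[where I = I])
      fix i assume "i < Suc n"
      then have "i \<le> n"
        by simp
      define f :: "nat \<Rightarrow> nat" where
        "f = (\<lambda>_. 0)(0 := halves n, 4 := n - k, 5 := n - j, 6 := Suc n - i,
           8 := Suc (k * n + j), 9 := base + k, 10 := base + j)"
      show "hoare (\<lambda>r m. r 6 = Suc n - i \<and> I i r m) relabel_vertex 8
          (\<lambda>r m. r 1 = 1 \<and> r 6 = Suc n - i \<and> I (Suc i) (r(6 := Suc n - Suc i)) m)"
        using hoare_relabel_vertex[OF assms \<open>i \<le> n\<close>, of L f]
        by (rule hoare_conseq) (simp_all add: I_def S_def common_def f_def)
    qed (simp add: I_def S_def common_def)
    have h3: "hoare (\<lambda>r m. r 6 = 0 \<and> I (Suc n) r m) (block [ADD 8 8 1, ADD 10 10 1]) 2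
      (\<lambda>r m. scanning k (Suc j) r m \<and> r 4 = n - k \<and> r 5 = n - j \<and> r 10 = base + Suc j)"
    proof (rule hoare_block)
      fix r m assume *: "r 6 = 0 \<and> I (Suc n) r m"
      then have "labels (Suc n) (relabel k j L) m"
        by (simp add: I_def labels_def less_Suc_eq_le)
      then have "\<exists>L. merged k (Suc j) L \<and> labels (Suc n) L m"
        using merged_relabel[OF True assms] by blast
      then show "case_prod (\<lambda>r m. scanning k (Suc j) r m \<and> r 4 = n - k \<and> r 5 = n - j \<and>
          r 10 = base + Suc j) (fold effect [ADD 8 8 1, ADD 10 10 1] (r, m))"
        using * by (simp add: I_def S_def scanning_def common_def)
    qed simp_all
    show ?thesis
      unfolding merge_entry_def
      by (rule hoare_time[OF hoare_seq[OF h1 hoare_seq[OF h2 h3]]]) simp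
  qed (simp add: hoare_def)
  from hoare_ex[of "\<lambda>L r m. S r m \<and> merged k j L \<and> labels (Suc n) L m", OF this] show ?thesis
    by (rule hoare_conseq) (auto simp: scanning_def S_def)
qed

lemma hoare_merge_row:
  assumes "k < n"
  shows "hoare (\<lambda>r m. r 4 = n - k \<and> scanning k 0 r m) merge_row (n * (10 * n + 22) + 5)
    (\<lambda>r m. r 4 = n - k \<and> scanning (Suc k) 0 r m)"
proof -
  define I where "I j r m \<longleftrightarrow> scanning k j r m \<and> r 4 = n - k \<and> r 10 = base + j"
    for j and r m :: "nat \<Rightarrow> nat"
  have h1: "hoare (\<lambda>r m. r 4 = n - k \<and> scanning k 0 r m) (block [ADD 10 3 20, ADD 5 2 20]) 2
      (\<lambda>r m. r 5 = n \<and> I 0 r m)"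
    by (rule hoare_block) (simp_all add: I_def scanning_def common_def)
  have h2: "hoare (\<lambda>r m. r 5 = n \<and> I 0 r m) (loop 5 merge_entry) (n * (10 * n + 20 + 2) + 2)
      (\<lambda>r m. r 5 = 0 \<and> I n r m)"
  proof (rule hoare_loop[where I = I])
    show "hoare (\<lambda>r m. r 5 = n - j \<and> I j r m) merge_entry (10 * n + 20)
        (\<lambda>r m. r 1 = 1 \<and> r 5 = n - j \<and> I (Suc j) (r(5 := n - Suc j)) m)" if "j < n" for j
      using hoare_merge_entry[OF assms that]
      by (rule hoare_conseq) (simp_all add: I_def scanning_def common_def)
  qed (simp add: I_def scanning_def common_def)
  have h3: "hoare (\<lambda>r m. r 5 = 0 \<and> I n r m) (block [ADD 9 9 1]) 1
      (\<lambda>r m. r 4 = n - k \<and> scanning (Suc k) 0 r m)"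
    using merged_next_row
    by (intro hoare_block) (auto simp: I_def scanning_def common_def)
  show ?thesis
    unfolding merge_row_def
    by (rule hoare_time[OF hoare_seq[OF h1 hoare_seq[OF h2 h3]]]) simp
qed

definition fixpoints :: "(nat \<Rightarrow> nat) \<Rightarrow> nat \<Rightarrow> nat" where
  "fixpoints L k = card {x. x < k \<and> L x = x}"

lemma fixpoints_Suc: "fixpoints L (Suc k) = fixpoints L k + (if L k = k then 1 else 0)"
proof -
  have "{x. x < Suc k \<and> L x = x} =
      (if L k = k then insert k {x. x < k \<and> L x = x} else {x. x < k \<and> L x = x})"
    by (auto simp: less_Suc_eq)
  then show ?thesis
    by (simp add: fixpoints_def)
qed

lemma hoare_program:
  "hoare (\<lambda>r m. r = (\<lambda>_. 0) \<and> m = M) program (60 * Suc n ^ 3)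
     (\<lambda>r m. r 0 = halves n + card (cl ` {..n}) - Suc n)"
proof -
  define I where "I k r m \<longleftrightarrow> common r m \<and> labels k first_label m \<and>
      r 8 = Suc (k * n) \<and> r 9 = base + k \<and> r 0 = halves k" for k and r m :: "nat \<Rightarrow> nat"
  have h2: "hoare (\<lambda>r m. r 4 = n \<and> I 0 r m) (loop 4 row_scan) (n * (8 * n + 9 + 2) + 2)
      (\<lambda>r m. r 4 = 0 \<and> I n r m)"
  proof (rule hoare_loop[where I = I])
    show "hoare (\<lambda>r m. r 4 = n - k \<and> I k r m) row_scan (8 * n + 9)
        (\<lambda>r m. r 1 = 1 \<and> r 4 = n - k \<and> I (Suc k) (r(4 := n - Suc k)) m)" if "k < n" for k
      using hoare_row_scan[OF that]
      by (rule hoare_conseq) (simp_all add: I_def common_def)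
  qed (simp add: I_def common_def)
  have h1: "hoare (\<lambda>r m. r = (\<lambda>_. 0) \<and> m = M) address_setup (3 * n + 10)
      (\<lambda>r m. r 4 = n \<and> I 0 r m)"
    using hoare_address_setup
    by (rule hoare_conseq) (simp_all add: I_def labels_def halves_def)
  have h3: "hoare (\<lambda>r m. r 4 = 0 \<and> I n r m) (block [ST 16 16, LI 8 1, ADD 9 3 20, ADD 4 2 20]) 4
      (\<lambda>r m. r 4 = n \<and> scanning 0 0 r m)"
  proof (rule hoare_block)
    fix r m assume *: "r 4 = 0 \<and> I n r m"
    \<comment> \<open>The row scan labelled only the \<open>n\<close> vertices; this store adds the
      extra one.\<close>
    then have "labels (Suc n) first_label (m(base + n := base + n))"
      by (auto simp: I_def labels_def first_label_def less_Suc_eq)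
    then have "\<exists>L. merged 0 0 L \<and> labels (Suc n) L (m(base + n := base + n))"
      using merged_first_label by blast
    then show "case_prod (\<lambda>r m. r 4 = n \<and> scanning 0 0 r m)
        (fold effect [ST 16 16, LI 8 1, ADD 9 3 20, ADD 4 2 20] (r, m))"
      using * by (simp add: I_def scanning_def common_def)
  qed simp_all
  have h4: "hoare (\<lambda>r m. r 4 = n \<and> scanning 0 0 r m) (loop 4 merge_row)
      (n * (n * (10 * n + 22) + 5 + 2) + 2) (\<lambda>r m. r 4 = 0 \<and> scanning n 0 r m)"
  proof (rule hoare_loop[where I = "\<lambda>k. scanning k 0"])
    show "hoare (\<lambda>r m. r 4 = n - k \<and> scanning k 0 r m) merge_row (n * (10 * n + 22) + 5)
        (\<lambda>r m. r 1 = 1 \<and> r 4 = n - k \<and> scanning (Suc k) 0 (r(4 := n - Suc k)) m)" if "k < n" for k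
      using hoare_merge_row[OF that]
      by (rule hoare_conseq) (simp_all add: scanning_def common_def)
  qed (simp add: scanning_def common_def)
  have "hoare (\<lambda>r m. (r 4 = 0 \<and> scanning n 0 r m) \<and> merged n 0 L \<and> labels (Suc n) L m)
      (block [ADD 9 3 20, ADD 4 2 1] ;; loop 4 count_label ;; block [SUB 0 0 2, SUB 0 0 1])
      (9 * n + 20) (\<lambda>r m. r 0 = halves n + card (cl ` {..n}) - Suc n)" for L
  proof (cases "merged n 0 L")
    case True
    have fix_L: "fixpoints L (Suc n) = card (cl ` {..n})"
      using card_fixpoints_merged[OF True] by (simp add: fixpoints_def less_Suc_eq_le)
    define J where "J k r m \<longleftrightarrow> common r m \<and> labels (Suc n) L m \<and>
        r 9 = base + k \<and> r 0 = halves n + fixpoints L k" for k and r m :: "nat \<Rightarrow> nat"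
    have j1: "hoare (\<lambda>r m. (r 4 = 0 \<and> scanning n 0 r m) \<and> merged n 0 L \<and> labels (Suc n) L m)
        (block [ADD 9 3 20, ADD 4 2 1]) 2 (\<lambda>r m. r 4 = Suc n \<and> J 0 r m)"
      by (rule hoare_block) (simp_all add: J_def scanning_def common_def fixpoints_def)
    have j2: "hoare (\<lambda>r m. r 4 = Suc n \<and> J 0 r m) (loop 4 count_label) (Suc n * (7 + 2) + 2)
        (\<lambda>r m. r 4 = 0 \<and> J (Suc n) r m)"
    proof (rule hoare_loop[where I = J])
      fix k assume "k < Suc n"
      moreover have "1 - (L k - k + (k - L k)) = (if L k = k then 1 else 0)"
        by auto
      ultimately show "hoare (\<lambda>r m. r 4 = Suc n - k \<and> J k r m) count_label 7
          (\<lambda>r m. r 1 = 1 \<and> r 4 = Suc n - k \<and> J (Suc k) (r(4 := Suc n - Suc k)) m)"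
        unfolding count_label_def
        by (intro hoare_block) (simp_all add: J_def common_def labels_def fixpoints_Suc)
    qed (simp add: J_def common_def)
    have j3: "hoare (\<lambda>r m. r 4 = 0 \<and> J (Suc n) r m) (block [SUB 0 0 2, SUB 0 0 1]) 2
        (\<lambda>r m. r 0 = halves n + card (cl ` {..n}) - Suc n)"
      by (rule hoare_block) (simp_all add: J_def common_def fix_L)
    show ?thesis
      by (rule hoare_time[OF hoare_seq[OF j1 hoare_seq[OF j2 j3]]]) simp
  qed (simp add: hoare_def)
  from hoare_ex[of "\<lambda>L r m. (r 4 = 0 \<and> scanning n 0 r m) \<and> merged n 0 L \<and> labels (Suc n) L m", OF this]
  have h5: "hoare (\<lambda>r m. r 4 = 0 \<and> scanning n 0 r m)
      (block [ADD 9 3 20, ADD 4 2 1] ;; loop 4 count_label ;; block [SUB 0 0 2, SUB 0 0 1])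
      (9 * n + 20) (\<lambda>r m. r 0 = halves n + card (cl ` {..n}) - Suc n)"
    by (rule hoare_conseq) (auto simp: scanning_def)
  show ?thesis
    unfolding program_def
    \<comment> \<open>The bounds add up to \<open>10 * n ^ 3 + 30 * n ^ 2 + 30 * n + 38\<close>,
      which the claimed cubic exceeds coefficientwise.\<close>
    by (rule hoare_time[OF hoare_seq[OF h1 hoare_seq[OF h2 hoare_seq[OF h3 hoare_seq[OF h4 h5]]]]])
      (simp add: algebra_simps power3_eq_cube)
qed

end

section \<open>From the encoded graph to the abstract matrix input\<close>

lemma nth_concat_map:
  assumes "\<And>x. x \<in> set xs \<Longrightarrow> length (f x) = n" "i < length xs" "j < n"
  shows "concat (map f xs) ! (i * n + j) = f (xs ! i) ! j"
  using assms
proof (induction xs arbitrary: i)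
  case (Cons x xs)
  then show ?case
    by (cases i) (auto simp: nth_append add.assoc)
qed simp

lemma length_encode_graph: "length (encode_graph G vs) = 1 + length vs * length vs"
  by (simp add: encode_graph_def length_concat o_def sum_list_triv)

lemma encode_graph_entry:
  assumes "i < length vs" "j < length vs"
  shows "encode_graph G vs ! (1 + i * length vs + j) = (if (vs ! i, vs ! j) \<in> parcs G then 1 else 0)"
  using assms unfolding encode_graph_def by (simp add: nth_concat_map)

text \<open>Placed at address 0 the fragment is the whole program, so its end is a halted state,
  which persists up to any larger time bound.\<close>

lemma hoare_computes_within:
  assumes "hoare (\<lambda>r m. r = (\<lambda>_. 0) \<and> m = mem (initial_state x)) c t (\<lambda>r m. r 0 = y)" "t \<le> t'"
  shows "computes_within (c 0) x t' y"
proof -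
  let ?s = "\<lambda>t. (step (c 0) ^^ t) (initial_state x)"
  have "code_at (c 0) 0 (c 0)"
    by (auto simp: code_at_def)
  then have "runs (c 0) t (initial_state x) (length (c 0)) (\<lambda>r m. r 0 = y)"
    by (rule hoareD[OF assms(1)]) (simp_all add: initial_state_def)
  then obtain u where u: "u \<le> t" "pc (?s u) = length (c 0)" "reg (?s u) 0 = y"
    by (auto simp: runs_def)
  have "?s (d + u) = ?s u" for d
    using u(2) by (induction d) (simp_all add: step_def halted_def)
  from this[of "t' - u"] have "?s t' = ?s u"
    using u(1) assms(2) by simp
  then show ?thesis
    using u(2,3) by (simp add: computes_within_def halted_def)
qed

lemma sum_nth_distinct:
  assumes "distinct xs"
  shows "(\<Sum>i<length xs. f (xs ! i)) = sum f (set xs)"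
  using sum.reindex_bij_betw[OF bij_betw_nth[OF assms refl refl], of f] by simp

locale encoded_graph = simple_graph V E for V :: "'a set" and E +
  fixes vs :: "'a list"
  assumes distinct_vs: "distinct vs" and set_vs: "set vs = V"
begin

definition adj :: "nat \<Rightarrow> nat \<Rightarrow> nat" where
  "adj i j = (if (vs ! i, vs ! j) \<in> E then 1 else 0)"

text \<open>
  The odd vertices are linked to an extra vertex with index \<open>length vs\<close>, so all components that
  are not counted share the class \<open>{}\<close>.
\<close>

definition cls :: "nat \<Rightarrow> 'a set" where
  "cls i = (if i < length vs \<and> all_even E (component E (vs ! i)) then component E (vs ! i) else {})"

lemma nth_V: "i < length vs \<Longrightarrow> vs ! i \<in> V"
  using set_vs by auto

lemma sum_adj: "i < length vs \<Longrightarrow> (\<Sum>j<length vs. adj i j) = deg E (vs ! i)"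
proof -
  have "(\<Sum>j<length vs. adj i j) = (\<Sum>y\<in>V. if (vs ! i, y) \<in> E then 1 else 0)"
    using sum_nth_distinct[OF distinct_vs, of "\<lambda>y. if (vs ! i, y) \<in> E then 1 else 0"]
    by (simp add: adj_def set_vs)
  also have "\<dots> = (\<Sum>y\<in>{y \<in> V. (vs ! i, y) \<in> E}. 1)"
    using sum.inter_filter[OF finite_V, of "\<lambda>_. 1::nat"] by simp
  also have "{y \<in> V. (vs ! i, y) \<in> E} = E `` {vs ! i}"
    using E_V by blast
  finally show ?thesis
    by simp
qed

text \<open>A labelling constant along arcs is constant on components, and a component with an odd
  vertex takes the label of the extra vertex.\<close>

lemma cls_finest:
  fixes L :: "nat \<Rightarrow> nat"
  assumes arc: "\<And>i j. i < length vs \<Longrightarrow> j < length vs \<Longrightarrow> adj i j = 1 \<Longrightarrow> L i = L j"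
    and odd: "\<And>i. i < length vs \<Longrightarrow> odd (\<Sum>j<length vs. adj i j) \<Longrightarrow> L i = L (length vs)"
    and "x \<le> length vs" "y \<le> length vs" "cls x = cls y"
  shows "L x = L y"
proof -
  let ?n = "length vs"
  have conn: "L i = L j" if "(vs ! i, vs ! j) \<in> E\<^sup>*" "i < ?n" "j < ?n" for i j
  proof -
    have "\<forall>j<?n. vs ! j = w \<longrightarrow> L i = L j" if "(vs ! i, w) \<in> E\<^sup>*" for w
      using that
    proof (induction rule: rtrancl_induct)
      case base
      then show ?case
        using nth_eq_iff_index_eq[OF distinct_vs] \<open>i < ?n\<close> by auto
    next
      case (step u w)
      have "u \<in> set vs"
        using step.hyps(2) E_V set_vs by blast
      then obtain k where k: "k < ?n" "vs ! k = u"
        by (auto simp: in_set_conv_nth)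
      then have "L i = L k"
        using step.IH by blast
      moreover have "L k = L j" if "j < ?n" "vs ! j = w" for j
        using that k step.hyps(2) by (intro arc) (simp_all add: adj_def)
      ultimately show ?case
        by simp
    qed
    then show ?thesis
      using that by blast
  qed
  have uncounted: "L x = L ?n" if "x \<le> ?n" "cls x = {}" for x
  proof (cases "x = ?n")
    case False
    then have "x < ?n" "\<not> all_even E (component E (vs ! x))"
      using that by (auto simp: cls_def split: if_splits)
    then obtain w where w: "(vs ! x, w) \<in> E\<^sup>*" "odd (deg E w)"
      unfolding all_even_def by blast
    moreover from this have "w \<in> set vs"
      using comp_subset[OF nth_V[OF \<open>x < ?n\<close>]] set_vs by blast
    ultimately obtain j where j: "j < ?n" "vs ! j = w"
      by (auto simp: in_set_conv_nth)
    then have "L x = L j"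
      using conn w(1) \<open>x < ?n\<close> by simp
    also have "\<dots> = L ?n"
      using j w(2) by (intro odd) (simp_all add: sum_adj)
    finally show ?thesis .
  qed simp
  show ?thesis
  proof (cases "cls x = {}")
    case True
    then show ?thesis
      using uncounted assms(3-5) by simp
  next
    case False
    then have "x < ?n" "y < ?n" "component E (vs ! x) = component E (vs ! y)"
      using assms(5) by (auto simp: cls_def split: if_splits)
    then show ?thesis
      using conn comp_eq_iff by blast
  qed
qed

text \<open>The additional class is \<open>{}\<close>, that of the extra vertex; components are
  never empty.\<close>

lemma card_cls: "card (cls ` {..length vs}) = Suc (card (even_comps V E))"
proof -
  have "cls ` {..length vs} = insert {} (even_comps V E)"
  proof
    show "cls ` {..length vs} \<subseteq> insert {} (even_comps V E)"
      using nth_V by (auto simp: cls_def even_comps_def)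
    show "insert {} (even_comps V E) \<subseteq> cls ` {..length vs}"
    proof
      fix C assume "C \<in> insert {} (even_comps V E)"
      then consider "C = {}" | v where "v \<in> V" "C = component E v" "all_even E C"
        by (auto simp: even_comps_def)
      then show "C \<in> cls ` {..length vs}"
      proof cases
        case 1
        then have "C = cls (length vs)"
          by (simp add: cls_def)
        then show ?thesis by simp
      next
        case (2 v)
        then obtain i where "i < length vs" "vs ! i = v"
          using set_vs by (auto simp: in_set_conv_nth)
        with 2 have "C = cls i" "i \<in> {..length vs}"
          by (simp_all add: cls_def)
        then show ?thesis by (rule image_eqI)
      qed
    qed
  qed
  moreover have "{} \<notin> even_comps V E"
    by (auto simp: even_comps_def)
  ultimately show ?thesis
    using finite_even_comps by simp
qed

lemma matrix_input_adj:
  assumes "M 0 = length vs"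
    and "\<And>i j. i < length vs \<Longrightarrow> j < length vs \<Longrightarrow> M (1 + i * length vs + j) = adj i j"
  shows "matrix_input (length vs) adj M cls"
proof
  show "cls i = cls j" if "i < length vs" "j < length vs" "adj i j = 1" for i j
  proof -
    have "component E (vs ! i) = component E (vs ! j)"
      using that by (auto simp: comp_eq_iff adj_def split: if_splits)
    with that show ?thesis
      by (simp add: cls_def)
  qed
  show "cls i = cls (length vs)" if "i < length vs" "odd (\<Sum>j<length vs. adj i j)" for i
    using that by (auto simp: cls_def sum_adj all_even_def)
  show "L x = L y"
    if "\<And>i j. i < length vs \<Longrightarrow> j < length vs \<Longrightarrow> adj i j = 1 \<Longrightarrow> L i = L j"
      and "\<And>i. i < length vs \<Longrightarrow> odd (\<Sum>j<length vs. adj i j) \<Longrightarrow> L i = L (length vs)"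
      and "x \<le> length vs" "y \<le> length vs" "cls x = cls y"
    for L :: "nat \<Rightarrow> nat" and x y
    using that by (rule cls_finest)
  show "adj i j \<le> 1" for i j
    by (simp add: adj_def)
qed (fact assms)+

lemma halves_adj: "matrix_input.halves (length vs) adj (length vs) = (\<Sum>v\<in>V. (deg E v + 1) div 2)"
  if "matrix_input (length vs) adj M cls"
proof -
  interpret matrix_input "length vs" adj M cls
    by (fact that)
  show ?thesis
    using sum_nth_distinct[OF distinct_vs, of "\<lambda>v. (deg E v + 1) div 2"]
    by (simp add: halves_def rowsum_def sum_adj set_vs)
qed

end

theorem theorem7:
  shows "\<exists>(P :: instr list) (p :: nat poly).
    \<forall>(G :: nat pair_pre_digraph) (vs :: nat list).
      pair_graph G \<longrightarrow> distinct vs \<longrightarrow> set vs = pverts G \<longrightarrow>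
      (\<exists>k. min_number_of_splits G k \<and>
           computes_within P (encode_graph G vs) (poly p (length (encode_graph G vs))) k)"
\<comment> \<open>The polynomial is 60 times the cube of 1 + x at the input length x, obtained by
  bounding the number of vertices crudely by x.\<close>
proof (intro exI[of _ "program 0"] exI[of _ "smult 60 ([:1, 1:] ^ 3)"] allI impI)
  fix G :: "nat pair_pre_digraph" and vs :: "nat list"
  assume G: "pair_graph G" and vs: "distinct vs" "set vs = pverts G"
  let ?x = "encode_graph G vs" and ?n = "length vs"
  let ?M = "mem (initial_state ?x)" and ?k = "graph_cost G - card (pverts G)"
  interpret simple_graph "pverts G" "parcs G"
    using G by (rule simple_graph_pair_graph)
  interpret encoded_graph "pverts G" "parcs G" vs
    using vs by unfold_locales
  have "i * ?n + j < ?n * ?n" if "i < ?n" "j < ?n" for i j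
  proof -
    have "i * ?n + j < Suc i * ?n"
      using that by simp
    also have "\<dots> \<le> ?n * ?n"
      using that by (intro mult_le_mono1) simp
    finally show ?thesis .
  qed
  then have input: "matrix_input ?n adj ?M cls"
    using encode_graph_entry[of _ vs _ G] length_encode_graph[of G vs]
    by (intro matrix_input_adj) (auto simp: initial_state_def adj_def encode_graph_def)
  have "card (pverts G) = ?n"
    using vs distinct_card by force
  \<comment> \<open>In \<open>Suc ?n\<close> the successor cancels the class of the extra vertex,
    and \<open>?n\<close> is the number of vertices.\<close>
  then have "matrix_input.halves ?n adj ?n + card (cls ` {..?n}) - Suc ?n = ?k"
    unfolding halves_adj[OF input] card_cls cost_def by simp
  then have "hoare (\<lambda>r m. r = (\<lambda>_. 0) \<and> m = ?M) program (60 * Suc ?n ^ 3) (\<lambda>r m. r 0 = ?k)"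
    using matrix_input.hoare_program[OF input] by simp
  moreover have "60 * Suc ?n ^ 3 \<le> poly (smult 60 ([:1, 1:] ^ 3)) (length ?x)"
  proof -
    have "?n \<le> ?n * ?n"
      by (rule le_square)
    then have "Suc ?n ^ 3 \<le> (1 + length ?x) ^ 3"
      unfolding length_encode_graph by (intro power_mono) linarith+
    then show ?thesis
      by simp
  qed
  ultimately have "computes_within (program 0) ?x (poly (smult 60 ([:1, 1:] ^ 3)) (length ?x)) ?k"
    by (rule hoare_computes_within)
  then show "\<exists>k. min_number_of_splits G k \<and>
      computes_within (program 0) ?x (poly (smult 60 ([:1, 1:] ^ 3)) (length ?x)) k"
    using min_number_of_splits_cost[OF G] by blast
qed

end
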